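(* Let $\Gamma$ be a finite group acting linearly on $\mathbb{R}^n$, let $d \in \mathbb{N}$, let $P_0,\ldots,P_N \in \mathbb{R}[x]$ be $\Gamma$-invariant polynomials, and let $G \subseteq \mathbb{R}[x]$ be a finite set of $\Gamma$-invariant polynomials. Assume that a real symmetry-adapted basis of the polynomial ring exists and has been chosen, and let $E_\pi^{k}(x)$ be the corresponding symmetric matrix polynomials (see context). Consider the identity $$P_0(x) + \sum_{i=1}^N y_i P_i(x) = \sum_{g \in G \cup \{1\}} g(x) \sum_{\pi \in \widehat\Gamma} \left\langle Y_{g,\pi}, E_\pi^{d-\lfloor\deg(g)/2\rfloor}(x) \right\rangle \qquad ( * )$$ in the variables $y \in \mathbb{R}^N$ and real symmetric (positive semidefinite) matrices $Y_{g,\pi}$, for $g \in G\cup\{1\}$ and $\pi \in \widehat\Gamma$. Let $M \subseteq \mathbb{R}^n$ be a minimal unisolvent set for the space $\mathbb{R}[x]^\Gamma_{\le 2d}$ of $\Gamma$-invariant polynomials of degree at most $2d$. Then evaluating $( * )$ at the points $x = x' \in M$ yields $|M|$ linearly independent linear constraints in the variables $(y, (Y_{g,\pi})_{g,\pi})$.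
   Context: Here $x = (x_1,\ldots,x_n)$, and $\Gamma$ acts on polynomials by $L(\gamma)p(x) = p(\gamma^{-1}x)$; a polynomial is $\Gamma$-invariant if it is fixed by all $L(\gamma)$. $\langle A,B\rangle$ denotes the trace inner product. Symmetry-adapted basis. Let $\widehat\Gamma$ be a complete set of (representatives of) irreducible representations $(\pi,V_\pi)$ of $\Gamma$, with $d_\pi = \dim V_\pi$. Decompose $\mathbb{C}[x] = \bigoplus_{\pi\in\widehat\Gamma}\bigoplus_i H_{\pi,i}$, where $H_{\pi,i}$ is a $\Gamma$-invariant subspace equivalent to $V_\pi$ and spanned by homogeneous polynomials of the same degree. Fix for each $\pi$ a basis of $V_\pi$ in which all $\pi(\gamma)$ are unitary matrices. A symmetry-adapted basis is a choice of bases $e_{\pi,i,1},\ldots,e_{\pi,i,d_\pi}$ of the spaces $H_{\pi,i}$ such that $L(\gamma)e_{\pi,i,j} = \sum_{k=1}^{d_\pi}\pi(\gamma)_{k,j}e_{\pi,i,k}$ for all $\gamma\in\Gamma$ and all $\pi,i,j$. It is called real here if all matrices $\pi(\gamma)$ (for $\pi$ occurring in $\mathbb{C}[x]$) are real orthogonal and all $e_{\pi,i,j}$ have real coefficients; this is the standing assumption. For each $\pi$, define the matrix polynomial $E_\pi(x)_{i,i'} = \frac{1}{d_\pi}\sum_{j=1}^{d_\pi}e_{\pi,i,j}(x)e_{\pi,i',j}(x)$, which is symmetric and $\Gamma$-invariant. For an integer $k$, $E_\pi^k(x)$ is the submatrix of $E_\pi(x)$ indexed by those rows and columns $i$ for which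 $\deg e_{\pi,i,j}\le k$ (this does not depend on $j$). The matrix $Y_{g,\pi}$ has the same size as $E_\pi^{d-\lfloor \deg(g)/2\rfloor}(x)$. Unisolvence. A set $M$ of points is unisolvent for a space $W$ of polynomials if every polynomial in $W$ that vanishes on $M$ is identically zero; it is minimal unisolvent if moreover no strict subset of $M$ is unisolvent for $W$. The constraints are called linearly independent if the linear functionals of the variables $(y,(Y_{g,\pi}))$ (with the $Y_{g,\pi}$ ranging over real symmetric matrices) that define them, one for each $x'\in M$, are linearly independent. *)

theory Defs
  imports
    "HOL-Analysis.Analysis"
    "HOL-Library.Poly_Mapping"
    "HOL-Library.Function_Algebras"
    "HOL-Algebra.Group_Action"
    "Jordan_Normal_Form.Schur_Decomposition"
begin

section \<open>Polynomials in the variables indexed by a finite type\<close>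

text \<open>A monomial is an exponent vector \<open>'n \<Rightarrow>\<^sub>0 nat\<close>; multiplication of polynomials is
  the convolution product of \<^theory>\<open>HOL-Library.Poly_Mapping\<close>.\<close>

type_synonym ('n, 'a) mpoly = "('n \<Rightarrow>\<^sub>0 nat) \<Rightarrow>\<^sub>0 'a"

definition Const :: "'a::comm_ring_1 \<Rightarrow> ('n, 'a) mpoly" where
  "Const c = Poly_Mapping.single 0 c"

definition Var :: "'n \<Rightarrow> ('n, 'a::comm_ring_1) mpoly" where
  "Var i = Poly_Mapping.single (Poly_Mapping.single i 1) 1"

definition scale :: "'a::comm_ring_1 \<Rightarrow> ('n, 'a) mpoly \<Rightarrow> ('n, 'a) mpoly" where
  "scale c p = Const c * p"

definition eval :: "('n::finite, 'a::comm_ring_1) mpoly \<Rightarrow> ('n \<Rightarrow> 'a) \<Rightarrow> 'a" where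
  "eval p x = (\<Sum>m\<in>Poly_Mapping.keys p.
      Poly_Mapping.lookup p m * (\<Prod>i\<in>UNIV. x i ^ Poly_Mapping.lookup m i))"

definition monom_degree :: "('n::finite \<Rightarrow>\<^sub>0 nat) \<Rightarrow> nat" where
  "monom_degree m = (\<Sum>i\<in>UNIV. Poly_Mapping.lookup m i)"

text \<open>Total degree; the zero polynomial gets degree 0.\<close>

definition deg :: "('n::finite, 'a::zero) mpoly \<Rightarrow> nat" where
  "deg p = Max (insert 0 (monom_degree ` Poly_Mapping.keys p))"

definition homogeneous :: "nat \<Rightarrow> ('n::finite, 'a::zero) mpoly \<Rightarrow> bool" where
  "homogeneous k p \<longleftrightarrow> (\<forall>m\<in>Poly_Mapping.keys p. monom_degree m = k)"

definition complexify :: "('n, real) mpoly \<Rightarrow> ('n, complex) mpoly" where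
  "complexify p = Poly_Mapping.map complex_of_real p"

interpretation mpoly: vector_space "scale :: 'a::field \<Rightarrow> ('n, 'a) mpoly \<Rightarrow> ('n, 'a) mpoly"
  by unfold_locales
    (simp_all add: scale_def Const_def algebra_simps single_add mult_single
      flip: mult.assoc)


section \<open>Linear actions\<close>

definition linear_action ::
    "('g, 'r) monoid_scheme \<Rightarrow> ('g \<Rightarrow> real ^ 'n \<Rightarrow> real ^ 'n) \<Rightarrow> bool" where
  "linear_action \<Gamma> \<phi> \<longleftrightarrow>
     group_action \<Gamma> UNIV \<phi> \<and> (\<forall>\<gamma>\<in>carrier \<Gamma>. Real_Vector_Spaces.linear (\<phi> \<gamma>))"

text \<open>\<open>act \<Gamma> \<phi> \<gamma>\<close> is \<open>L(\<gamma>)\<close>: each variable is replaced by the corresponding coordinate of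
  \<open>\<gamma>\<^sup>-\<^sup>1 x\<close>, a linear form in the variables (lemma \<open>eval_act\<close> below).\<close>

definition act ::
    "('g, 'r) monoid_scheme \<Rightarrow> ('g \<Rightarrow> real ^ 'n \<Rightarrow> real ^ 'n) \<Rightarrow> 'g \<Rightarrow>
      ('n::finite, 'a::real_field) mpoly \<Rightarrow> ('n, 'a) mpoly" where
  "act \<Gamma> \<phi> \<gamma> p = (\<Sum>m\<in>Poly_Mapping.keys p. scale (Poly_Mapping.lookup p m)
      (\<Prod>i\<in>UNIV. (\<Sum>j\<in>UNIV. scale
          (of_real (vec_nth (vec_nth (matrix (\<phi> (m_inv \<Gamma> \<gamma>))) i) j)) (Var j))
        ^ Poly_Mapping.lookup m i))"

definition invariant ::
    "('g, 'r) monoid_scheme \<Rightarrow> ('g \<Rightarrow> real ^ 'n \<Rightarrow> real ^ 'n) \<Rightarrow>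
      ('n::finite, 'a::real_field) mpoly \<Rightarrow> bool" where
  "invariant \<Gamma> \<phi> p \<longleftrightarrow> (\<forall>\<gamma>\<in>carrier \<Gamma>. act \<Gamma> \<phi> \<gamma> p = p)"


section \<open>Complex matrix representations\<close>

text \<open>Irreducible representations are given by their matrices with respect to a fixed basis,
  so that \<open>V\<^sub>\<pi>\<close> is \<open>carrier_vec (rep_dim \<Gamma> \<pi>)\<close>.\<close>

definition rep_dim :: "('g, 'r) monoid_scheme \<Rightarrow> ('g \<Rightarrow> complex mat) \<Rightarrow> nat" where
  "rep_dim \<Gamma> \<pi> = dim_row (\<pi> \<one>\<^bsub>\<Gamma>\<^esub>)"

definition matrix_rep :: "('g, 'r) monoid_scheme \<Rightarrow> ('g \<Rightarrow> complex mat) \<Rightarrow> bool" where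
  "matrix_rep \<Gamma> \<pi> \<longleftrightarrow>
     (\<forall>\<gamma>\<in>carrier \<Gamma>. \<pi> \<gamma> \<in> carrier_mat (rep_dim \<Gamma> \<pi>) (rep_dim \<Gamma> \<pi>)) \<and>
     \<pi> \<one>\<^bsub>\<Gamma>\<^esub> = 1\<^sub>m (rep_dim \<Gamma> \<pi>) \<and>
     (\<forall>\<gamma>\<in>carrier \<Gamma>. \<forall>\<delta>\<in>carrier \<Gamma>. \<pi> (\<gamma> \<otimes>\<^bsub>\<Gamma>\<^esub> \<delta>) = \<pi> \<gamma> * \<pi> \<delta>)"

definition vec_subspace :: "nat \<Rightarrow> complex Matrix.vec set \<Rightarrow> bool" where
  "vec_subspace n W \<longleftrightarrow> W \<subseteq> carrier_vec n \<and> 0\<^sub>v n \<in> W \<and>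
     (\<forall>v\<in>W. \<forall>w\<in>W. v + w \<in> W) \<and> (\<forall>c. \<forall>v\<in>W. c \<cdot>\<^sub>v v \<in> W)"

definition irreducible_rep :: "('g, 'r) monoid_scheme \<Rightarrow> ('g \<Rightarrow> complex mat) \<Rightarrow> bool" where
  "irreducible_rep \<Gamma> \<pi> \<longleftrightarrow> matrix_rep \<Gamma> \<pi> \<and> 0 < rep_dim \<Gamma> \<pi> \<and>
     (\<forall>W. vec_subspace (rep_dim \<Gamma> \<pi>) W \<and> (\<forall>\<gamma>\<in>carrier \<Gamma>. \<forall>v\<in>W. \<pi> \<gamma> *\<^sub>v v \<in> W) \<longrightarrow>
       W = {0\<^sub>v (rep_dim \<Gamma> \<pi>)} \<or> W = carrier_vec (rep_dim \<Gamma> \<pi>))"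

definition equivalent_reps ::
    "('g, 'r) monoid_scheme \<Rightarrow> ('g \<Rightarrow> complex mat) \<Rightarrow> ('g \<Rightarrow> complex mat) \<Rightarrow> bool" where
  "equivalent_reps \<Gamma> \<pi> \<sigma> \<longleftrightarrow> rep_dim \<Gamma> \<pi> = rep_dim \<Gamma> \<sigma> \<and>
     (\<exists>T\<in>carrier_mat (rep_dim \<Gamma> \<pi>) (rep_dim \<Gamma> \<pi>). invertible_mat T \<and>
       (\<forall>\<gamma>\<in>carrier \<Gamma>. T * \<pi> \<gamma> = \<sigma> \<gamma> * T))"

definition unitary_rep :: "('g, 'r) monoid_scheme \<Rightarrow> ('g \<Rightarrow> complex mat) \<Rightarrow> bool" where
  "unitary_rep \<Gamma> \<pi> \<longleftrightarrow>
     (\<forall>\<gamma>\<in>carrier \<Gamma>. \<pi> \<gamma> * mat_adjoint (\<pi> \<gamma>) = 1\<^sub>m (rep_dim \<Gamma> \<pi>))"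

definition real_orthogonal_rep :: "('g, 'r) monoid_scheme \<Rightarrow> ('g \<Rightarrow> complex mat) \<Rightarrow> bool" where
  "real_orthogonal_rep \<Gamma> \<pi> \<longleftrightarrow> (\<forall>\<gamma>\<in>carrier \<Gamma>.
     (\<forall>k<rep_dim \<Gamma> \<pi>. \<forall>j<rep_dim \<Gamma> \<pi>. \<pi> \<gamma> $$ (k, j) \<in> \<real>) \<and>
     \<pi> \<gamma> * transpose_mat (\<pi> \<gamma>) = 1\<^sub>m (rep_dim \<Gamma> \<pi>))"

definition complete_irreps :: "('g, 'r) monoid_scheme \<Rightarrow> ('g \<Rightarrow> complex mat) set \<Rightarrow> bool" where
  "complete_irreps \<Gamma> Irr \<longleftrightarrow>
     (\<forall>\<pi>\<in>Irr. irreducible_rep \<Gamma> \<pi>) \<and>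
     (\<forall>\<pi>\<in>Irr. \<forall>\<sigma>\<in>Irr. equivalent_reps \<Gamma> \<pi> \<sigma> \<longrightarrow> \<pi> = \<sigma>) \<and>
     (\<forall>\<rho>. irreducible_rep \<Gamma> \<rho> \<longrightarrow> (\<exists>\<pi>\<in>Irr. equivalent_reps \<Gamma> \<rho> \<pi>))"


section \<open>Symmetry-adapted bases\<close>

text \<open>Internal direct sum of subspaces: every polynomial is uniquely a finite sum of elements of the summands.\<close>

definition direct_sum_decomposition ::
    "'k set \<Rightarrow> ('k \<Rightarrow> ('n, complex) mpoly set) \<Rightarrow> bool" where
  "direct_sum_decomposition K H \<longleftrightarrow>
     (\<forall>k\<in>K. mpoly.subspace (H k)) \<and>
     (\<forall>p. \<exists>!f. (\<forall>k\<in>K. f k \<in> H k) \<and> (\<forall>k. k \<notin> K \<longrightarrow> f k = 0) \<and>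
        finite {k. f k \<noteq> 0} \<and> p = (\<Sum>k | f k \<noteq> 0. f k))"

definition subrep_equivalent ::
    "('g, 'r) monoid_scheme \<Rightarrow> ('g \<Rightarrow> real ^ 'n \<Rightarrow> real ^ 'n) \<Rightarrow>
      ('n::finite, complex) mpoly set \<Rightarrow> ('g \<Rightarrow> complex mat) \<Rightarrow> bool" where
  "subrep_equivalent \<Gamma> \<phi> W \<pi> \<longleftrightarrow>
     (\<exists>T. bij_betw T (carrier_vec (rep_dim \<Gamma> \<pi>)) W \<and>
        (\<forall>v\<in>carrier_vec (rep_dim \<Gamma> \<pi>). \<forall>w\<in>carrier_vec (rep_dim \<Gamma> \<pi>). T (v + w) = T v + T w) \<and>
        (\<forall>c. \<forall>v\<in>carrier_vec (rep_dim \<Gamma> \<pi>). T (c \<cdot>\<^sub>v v) = scale c (T v)) \<and>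
        (\<forall>\<gamma>\<in>carrier \<Gamma>. \<forall>v\<in>carrier_vec (rep_dim \<Gamma> \<pi>). T (\<pi> \<gamma> *\<^sub>v v) = act \<Gamma> \<phi> \<gamma> (T v)))"

definition irreducible_decomposition ::
    "('g, 'r) monoid_scheme \<Rightarrow> ('g \<Rightarrow> real ^ 'n \<Rightarrow> real ^ 'n) \<Rightarrow> ('g \<Rightarrow> complex mat) set \<Rightarrow>
      (('g \<Rightarrow> complex mat) \<Rightarrow> 'i set) \<Rightarrow>
      (('g \<Rightarrow> complex mat) \<Rightarrow> 'i \<Rightarrow> ('n::finite, complex) mpoly set) \<Rightarrow> bool" where
  "irreducible_decomposition \<Gamma> \<phi> Irr I H \<longleftrightarrow>
     direct_sum_decomposition (Sigma Irr I) (\<lambda>(\<pi>, i). H \<pi> i) \<and>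
     (\<forall>\<pi>\<in>Irr. \<forall>i\<in>I \<pi>.
        (\<forall>\<gamma>\<in>carrier \<Gamma>. act \<Gamma> \<phi> \<gamma> ` H \<pi> i \<subseteq> H \<pi> i) \<and>
        subrep_equivalent \<Gamma> \<phi> (H \<pi> i) \<pi> \<and>
        (\<exists>k B. (\<forall>p\<in>B. homogeneous k p) \<and> mpoly.span B = H \<pi> i))"

text \<open>The basis indices \<open>j\<close> run over \<open>0, \<dots>, d\<^sub>\<pi> - 1\<close>, matching the indexing of matrices.\<close>

definition symmetry_adapted_basis ::
    "('g, 'r) monoid_scheme \<Rightarrow> ('g \<Rightarrow> real ^ 'n \<Rightarrow> real ^ 'n) \<Rightarrow> ('g \<Rightarrow> complex mat) set \<Rightarrow>
      (('g \<Rightarrow> complex mat) \<Rightarrow> 'i set) \<Rightarrow>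
      (('g \<Rightarrow> complex mat) \<Rightarrow> 'i \<Rightarrow> ('n::finite, complex) mpoly set) \<Rightarrow>
      (('g \<Rightarrow> complex mat) \<Rightarrow> 'i \<Rightarrow> nat \<Rightarrow> ('n, complex) mpoly) \<Rightarrow> bool" where
  "symmetry_adapted_basis \<Gamma> \<phi> Irr I H e \<longleftrightarrow>
     complete_irreps \<Gamma> Irr \<and> (\<forall>\<pi>\<in>Irr. unitary_rep \<Gamma> \<pi>) \<and>
     irreducible_decomposition \<Gamma> \<phi> Irr I H \<and>
     (\<forall>\<pi>\<in>Irr. \<forall>i\<in>I \<pi>.
        inj_on (e \<pi> i) {..<rep_dim \<Gamma> \<pi>} \<and>
        mpoly.independent (e \<pi> i ` {..<rep_dim \<Gamma> \<pi>}) \<and>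
        mpoly.span (e \<pi> i ` {..<rep_dim \<Gamma> \<pi>}) = H \<pi> i \<and>
        (\<forall>\<gamma>\<in>carrier \<Gamma>. \<forall>j<rep_dim \<Gamma> \<pi>.
           act \<Gamma> \<phi> \<gamma> (e \<pi> i j) =
             (\<Sum>k<rep_dim \<Gamma> \<pi>. scale (\<pi> \<gamma> $$ (k, j)) (e \<pi> i k))))"

text \<open>Reality of the basis polynomials is expressed by their type.  Only the representations
  that occur in \<open>\<complex>[x]\<close>, i.e. those with \<open>I \<pi> \<noteq> {}\<close>, are required to be real.\<close>

definition real_symmetry_adapted_basis ::
    "('g, 'r) monoid_scheme \<Rightarrow> ('g \<Rightarrow> real ^ 'n \<Rightarrow> real ^ 'n) \<Rightarrow> ('g \<Rightarrow> complex mat) set \<Rightarrow>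
      (('g \<Rightarrow> complex mat) \<Rightarrow> 'i set) \<Rightarrow>
      (('g \<Rightarrow> complex mat) \<Rightarrow> 'i \<Rightarrow> ('n::finite, complex) mpoly set) \<Rightarrow>
      (('g \<Rightarrow> complex mat) \<Rightarrow> 'i \<Rightarrow> nat \<Rightarrow> ('n, real) mpoly) \<Rightarrow> bool" where
  "real_symmetry_adapted_basis \<Gamma> \<phi> Irr I H e \<longleftrightarrow>
     symmetry_adapted_basis \<Gamma> \<phi> Irr I H (\<lambda>\<pi> i j. complexify (e \<pi> i j)) \<and>
     (\<forall>\<pi>\<in>Irr. I \<pi> \<noteq> {} \<longrightarrow> real_orthogonal_rep \<Gamma> \<pi>)"


section \<open>The matrix polynomials and the constraints\<close>

definition E_mat ::
    "('g, 'r) monoid_scheme \<Rightarrow> (('g \<Rightarrow> complex mat) \<Rightarrow> 'i \<Rightarrow> nat \<Rightarrow> ('n, real) mpoly) \<Rightarrow>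
      ('g \<Rightarrow> complex mat) \<Rightarrow> 'i \<Rightarrow> 'i \<Rightarrow> ('n, real) mpoly" where
  "E_mat \<Gamma> e \<pi> i i' =
     scale (1 / real (rep_dim \<Gamma> \<pi>)) (\<Sum>j<rep_dim \<Gamma> \<pi>. e \<pi> i j * e \<pi> i' j)"

text \<open>Row and column indices of \<open>E\<^sub>\<pi>\<^sup>k\<close>; the integer \<open>k\<close> may be negative, and then there are none.\<close>

definition block_index ::
    "('g, 'r) monoid_scheme \<Rightarrow> (('g \<Rightarrow> complex mat) \<Rightarrow> 'i set) \<Rightarrow>
      (('g \<Rightarrow> complex mat) \<Rightarrow> 'i \<Rightarrow> nat \<Rightarrow> ('n::finite, real) mpoly) \<Rightarrow>
      ('g \<Rightarrow> complex mat) \<Rightarrow> int \<Rightarrow> 'i set" where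
  "block_index \<Gamma> I e \<pi> k = {i \<in> I \<pi>. \<forall>j<rep_dim \<Gamma> \<pi>. int (deg (e \<pi> i j)) \<le> k}"

definition trace_inner ::
    "'i set \<Rightarrow> ('i \<Rightarrow> 'i \<Rightarrow> real) \<Rightarrow> ('i \<Rightarrow> 'i \<Rightarrow> ('n, real) mpoly) \<Rightarrow> ('n, real) mpoly" where
  "trace_inner J A B = (\<Sum>i\<in>J. \<Sum>i'\<in>J. scale (A i i') (B i i'))"

definition trunc :: "nat \<Rightarrow> ('n::finite, real) mpoly \<Rightarrow> int" where
  "trunc d g = int d - int (deg g div 2)"

type_synonym ('g, 'i, 'n) vars =
  "(nat \<Rightarrow> real) \<times> (('n, real) mpoly \<Rightarrow> ('g \<Rightarrow> complex mat) \<Rightarrow> 'i \<Rightarrow> 'i \<Rightarrow> real)"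

definition var_space ::
    "('g, 'r) monoid_scheme \<Rightarrow> ('g \<Rightarrow> complex mat) set \<Rightarrow> (('g \<Rightarrow> complex mat) \<Rightarrow> 'i set) \<Rightarrow>
      (('g \<Rightarrow> complex mat) \<Rightarrow> 'i \<Rightarrow> nat \<Rightarrow> ('n::finite, real) mpoly) \<Rightarrow>
      nat \<Rightarrow> nat \<Rightarrow> ('n, real) mpoly set \<Rightarrow> ('g, 'i, 'n) vars set" where
  "var_space \<Gamma> Irr I e d N G = {(y, Y).
     (\<forall>k. k \<notin> {1..N} \<longrightarrow> y k = 0) \<and>
     (\<forall>g \<pi> i i'. \<not> (g \<in> insert 1 G \<and> \<pi> \<in> Irr \<and>
        i \<in> block_index \<Gamma> I e \<pi> (trunc d g) \<and> i' \<in> block_index \<Gamma> I e \<pi> (trunc d g)) \<longrightarrow>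
        Y g \<pi> i i' = 0) \<and>
     (\<forall>g \<pi> i i'. Y g \<pi> i i' = Y g \<pi> i' i)}"

definition scale_vars :: "real \<Rightarrow> ('g, 'i, 'n) vars \<Rightarrow> ('g, 'i, 'n) vars" where
  "scale_vars c = (\<lambda>(y, Y). (\<lambda>k. c * y k, \<lambda>g \<pi> i i'. c * Y g \<pi> i i'))"

definition lhs_poly ::
    "(nat \<Rightarrow> ('n, real) mpoly) \<Rightarrow> nat \<Rightarrow> ('g, 'i, 'n) vars \<Rightarrow> ('n, real) mpoly" where
  "lhs_poly P N v = P 0 + (\<Sum>i=1..N. scale (fst v i) (P i))"

definition rhs_poly ::
    "('g, 'r) monoid_scheme \<Rightarrow> ('g \<Rightarrow> complex mat) set \<Rightarrow> (('g \<Rightarrow> complex mat) \<Rightarrow> 'i set) \<Rightarrow>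
      (('g \<Rightarrow> complex mat) \<Rightarrow> 'i \<Rightarrow> nat \<Rightarrow> ('n::finite, real) mpoly) \<Rightarrow>
      nat \<Rightarrow> ('n, real) mpoly set \<Rightarrow> ('g, 'i, 'n) vars \<Rightarrow> ('n, real) mpoly" where
  "rhs_poly \<Gamma> Irr I e d G v = (\<Sum>g\<in>insert 1 G. g * (\<Sum>\<pi>\<in>Irr.
     trace_inner (block_index \<Gamma> I e \<pi> (trunc d g)) (snd v g \<pi>) (E_mat \<Gamma> e \<pi>)))"

text \<open>The variable part of the constraint obtained by evaluating \<open>lhs_poly = rhs_poly\<close> at \<open>x\<close>;
  the constraint reads \<open>constraint_functional \<dots> x v = - P\<^sub>0(x)\<close>.\<close>

definition constraint_functional ::
    "('g, 'r) monoid_scheme \<Rightarrow> ('g \<Rightarrow> complex mat) set \<Rightarrow> (('g \<Rightarrow> complex mat) \<Rightarrow> 'i set) \<Rightarrow>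
      (('g \<Rightarrow> complex mat) \<Rightarrow> 'i \<Rightarrow> nat \<Rightarrow> ('n::finite, real) mpoly) \<Rightarrow>
      nat \<Rightarrow> (nat \<Rightarrow> ('n, real) mpoly) \<Rightarrow> nat \<Rightarrow> ('n, real) mpoly set \<Rightarrow>
      real ^ 'n \<Rightarrow> ('g, 'i, 'n) vars \<Rightarrow> real" where
  "constraint_functional \<Gamma> Irr I e d P N G x v =
     (\<Sum>i=1..N. fst v i * eval (P i) (vec_nth x)) -
     (\<Sum>g\<in>insert 1 G. eval g (vec_nth x) * (\<Sum>\<pi>\<in>Irr.
        \<Sum>i\<in>block_index \<Gamma> I e \<pi> (trunc d g). \<Sum>i'\<in>block_index \<Gamma> I e \<pi> (trunc d g).
          snd v g \<pi> i i' * eval (E_mat \<Gamma> e \<pi> i i') (vec_nth x)))"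

text \<open>Linear independence of the family \<open>l\<close> indexed by \<open>M\<close>, as functionals on \<open>V\<close>; in particular
  \<open>l\<close> is then injective on \<open>M\<close>.\<close>

definition independent_functionals :: "'v set \<Rightarrow> 'm set \<Rightarrow> ('m \<Rightarrow> 'v \<Rightarrow> real) \<Rightarrow> bool" where
  "independent_functionals V M l \<longleftrightarrow>
     (\<forall>S c. finite S \<and> S \<subseteq> M \<and> (\<forall>v\<in>V. (\<Sum>x\<in>S. c x * l x v) = 0) \<longrightarrow> (\<forall>x\<in>S. c x = 0))"


section \<open>Unisolvence\<close>

definition unisolvent :: "(real ^ 'n) set \<Rightarrow> ('n::finite, real) mpoly set \<Rightarrow> bool" where
  "unisolvent M W \<longleftrightarrow> (\<forall>p\<in>W. (\<forall>x\<in>M. eval p (vec_nth x) = 0) \<longrightarrow> p = 0)"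

definition minimal_unisolvent :: "(real ^ 'n) set \<Rightarrow> ('n::finite, real) mpoly set \<Rightarrow> bool" where
  "minimal_unisolvent M W \<longleftrightarrow> unisolvent M W \<and> (\<forall>M'. M' \<subset> M \<longrightarrow> \<not> unisolvent M' W)"

definition invariants_upto ::
    "('g, 'r) monoid_scheme \<Rightarrow> ('g \<Rightarrow> real ^ 'n \<Rightarrow> real ^ 'n) \<Rightarrow> nat \<Rightarrow>
      ('n::finite, real) mpoly set" where
  "invariants_upto \<Gamma> \<phi> k = {p. invariant \<Gamma> \<phi> p \<and> deg p \<le> k}"


section \<open>Evaluation of the action\<close>

lemma eval_superset:
  assumes "finite S" "Poly_Mapping.keys p \<subseteq> S"
  shows "eval p x = (\<Sum>m\<in>S. Poly_Mapping.lookup p m * (\<Prod>i\<in>UNIV. x i ^ Poly_Mapping.lookup m i))"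
  unfolding eval_def
  by (rule sum.mono_neutral_left) (use assms in \<open>auto simp: in_keys_iff\<close>)

lemma eval_add: "eval (p + q) x = eval p x + eval q x"
proof -
  let ?S = "Poly_Mapping.keys p \<union> Poly_Mapping.keys q"
  have "Poly_Mapping.keys (p + q) \<subseteq> ?S" by (rule keys_add)
  then show ?thesis
    by (simp add: eval_superset[of ?S] lookup_add distrib_right sum.distrib)
qed

lemma eval_sum: "eval (\<Sum>a\<in>A. f a) x = (\<Sum>a\<in>A. eval (f a) x)"
proof (induction A rule: infinite_finite_induct)
  case (insert a A)
  then show ?case by (simp add: eval_add)
qed (simp_all add: eval_def)

lemma eval_single:
  "eval (Poly_Mapping.single m c) x = c * (\<Prod>i\<in>UNIV. x i ^ Poly_Mapping.lookup m i)"
  by (subst eval_superset[of "{m}"]) auto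

lemma eval_mult:
  fixes p q :: "('n::finite, 'a::comm_ring_1) mpoly"
  shows "eval (p * q) x = eval p x * eval q x"
proof -
  have mono: "p =
      (\<Sum>m\<in>Poly_Mapping.keys p. Poly_Mapping.single m (Poly_Mapping.lookup p m))"
    for p :: "('n, 'a) mpoly"
    by (rule poly_mapping_eqI) (auto simp: lookup_sum lookup_single when_def in_keys_iff)
  have "p * q = (\<Sum>m\<in>Poly_Mapping.keys p. \<Sum>m'\<in>Poly_Mapping.keys q.
      Poly_Mapping.single (m + m') (Poly_Mapping.lookup p m * Poly_Mapping.lookup q m'))"
    by (subst mono[of p], subst mono[of q]) (simp add: sum_product mult_single)
  then have "eval (p * q) x = (\<Sum>m\<in>Poly_Mapping.keys p. \<Sum>m'\<in>Poly_Mapping.keys q.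
      (Poly_Mapping.lookup p m * Poly_Mapping.lookup q m') *
      (\<Prod>i\<in>UNIV. x i ^ Poly_Mapping.lookup (m + m') i))"
    by (simp add: eval_sum eval_single)
  also have "\<dots> = eval p x * eval q x"
    unfolding eval_def sum_product
    by (intro sum.cong refl) (simp add: lookup_add power_add prod.distrib mult_ac)
  finally show ?thesis .
qed

lemma eval_Const: "eval (Const c) x = c"
  by (simp add: Const_def eval_single)

lemma eval_scale: "eval (scale c p) x = c * eval p x"
  by (simp add: scale_def eval_mult eval_Const)

lemma eval_Var: "eval (Var i) x = x i"
proof -
  have "(\<Prod>j\<in>UNIV. x j ^ Poly_Mapping.lookup (Poly_Mapping.single i (1::nat)) j) =
      (\<Prod>j\<in>UNIV. if j = i then x j else 1)"
    by (intro prod.cong refl) (auto simp: lookup_single when_def)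
  then show ?thesis by (simp add: Var_def eval_single)
qed

lemma eval_one: "eval 1 x = 1"
  using eval_Const[of 1 x] by (simp add: Const_def)

lemma eval_power: "eval (p ^ k) x = eval p x ^ k"
  by (induction k) (simp_all add: eval_mult eval_one)

lemma eval_prod: "eval (\<Prod>a\<in>A. f a) x = (\<Prod>a\<in>A. eval (f a) x)"
  by (induction A rule: infinite_finite_induct) (simp_all add: eval_mult eval_one)

lemma eval_act:
  fixes p :: "('n::finite, 'a::real_field) mpoly" and x :: "real ^ 'n"
  assumes "linear_action \<Gamma> \<phi>" "group \<Gamma>" "\<gamma> \<in> carrier \<Gamma>"
  shows "eval (act \<Gamma> \<phi> \<gamma> p) (\<lambda>i. of_real (vec_nth x i)) =
    eval p (\<lambda>i. of_real (vec_nth (\<phi> (m_inv \<Gamma> \<gamma>) x) i))"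
proof -
  let ?A = "matrix (\<phi> (m_inv \<Gamma> \<gamma>))"
  have "Real_Vector_Spaces.linear (\<phi> (m_inv \<Gamma> \<gamma>))"
    using assms by (auto simp: linear_action_def)
  then have "\<phi> (m_inv \<Gamma> \<gamma>) x = ?A *v x"
    by simp
  then have "of_real (vec_nth (\<phi> (m_inv \<Gamma> \<gamma>) x) i) =
      (\<Sum>j\<in>UNIV. of_real (vec_nth (vec_nth ?A i) j) * (of_real (vec_nth x j) :: 'a))" for i
    by (simp add: matrix_vector_mult_def)
  then show ?thesis
    by (simp add: act_def eval_sum eval_scale eval_prod eval_power eval_Var)
      (simp add: eval_def)
qed

end

theory Submission
  imports Defs "Jordan_Normal_Form.Spectral_Radius"
begin

text \<open>The reason for the independence is that the entries of \<open>E\<^sub>\<pi>\<^sup>d\<close> span the invariants of degree at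
  most \<open>2d\<close>.  Minimality of \<open>M\<close> provides for each \<open>x \<in> M\<close> an invariant of degree at most \<open>2d\<close> that
  vanishes on \<open>M - {x}\<close> and not at \<open>x\<close> (\<open>minimal_unisolvent_witness\<close>).  In particular \<open>M\<close> is finite,
  and no nontrivial combination of evaluations at points of \<open>M\<close> annihilates all these invariants.
  A relation between the constraint functionals, restricted to the variables \<open>Y\<^sub>1\<^sub>,\<^sub>\<pi>\<close>, is a combination
  of evaluations that annihilates every entry of every \<open>E\<^sub>\<pi>\<^sup>d\<close> (\<open>constraint_functional_unit\<close>), so it is
  trivial.  The variables with \<open>g = 1\<close> alone already force independence.

  The spanning property is used in its dual form \<open>annihilates_invariants\<close>.  The basis polynomials of
  degree at most \<open>d\<close> span all monomials of degree at most \<open>d\<close>, because each \<open>H\<^sub>\<pi>\<^sub>,\<^sub>i\<close> is homogeneous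
  (\<open>monomial_in_span_adapted\<close>); so their pairwise products span the polynomials of degree at most
  \<open>2d\<close>.  The average over the group of such a product is an entry of some \<open>E\<^sub>\<pi>\<^sup>d\<close> or zero
  (\<open>orbit_sum_ec_mult\<close>), by Schur orthogonality.

  Schur orthogonality also shows that there are only finitely many irreducible representations
  (\<open>finite_complete_irreps\<close>), and homogeneity together with the directness of the decomposition that
  each \<open>E\<^sub>\<pi>\<^sup>d\<close> has finite size (\<open>finite_block_index\<close>).  Both are needed because sums over infinite index
  sets are zero by convention, which would remove the variables from the constraints.\<close>

section \<open>Schur orthogonality\<close>

lemma mat_mult_entry:
  fixes A B :: "'a::comm_semiring_1 mat"
  assumes "A \<in> carrier_mat n m" "B \<in> carrier_mat m p" "i < n" "j < p"
  shows "(A * B) $$ (i, j) = (\<Sum>k<m. A $$ (i, k) * B $$ (k, j))"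
  using assms by (auto simp: scalar_prod_def lessThan_atLeast0 intro!: sum.cong)

lemma matrix_repD:
  assumes "matrix_rep \<Gamma> \<pi>"
  shows "\<gamma> \<in> carrier \<Gamma> \<Longrightarrow> \<pi> \<gamma> \<in> carrier_mat (rep_dim \<Gamma> \<pi>) (rep_dim \<Gamma> \<pi>)"
    and "\<pi> \<one>\<^bsub>\<Gamma>\<^esub> = 1\<^sub>m (rep_dim \<Gamma> \<pi>)"
    and "\<gamma> \<in> carrier \<Gamma> \<Longrightarrow> \<delta> \<in> carrier \<Gamma> \<Longrightarrow> \<pi> (\<gamma> \<otimes>\<^bsub>\<Gamma>\<^esub> \<delta>) = \<pi> \<gamma> * \<pi> \<delta>"
  using assms by (auto simp: matrix_rep_def)

lemma irreducible_repD:
  assumes "irreducible_rep \<Gamma> \<pi>"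
  shows "matrix_rep \<Gamma> \<pi>" and "0 < rep_dim \<Gamma> \<pi>"
    and "\<lbrakk>vec_subspace (rep_dim \<Gamma> \<pi>) W; \<And>\<gamma> v. \<lbrakk>\<gamma> \<in> carrier \<Gamma>; v \<in> W\<rbrakk> \<Longrightarrow> \<pi> \<gamma> *\<^sub>v v \<in> W\<rbrakk> \<Longrightarrow>
       W = {0\<^sub>v (rep_dim \<Gamma> \<pi>)} \<or> W = carrier_vec (rep_dim \<Gamma> \<pi>)"
  using assms unfolding irreducible_rep_def by blast+

text \<open>Schur's lemma is split into its two halves: the kernel of an intertwiner is an invariant
  subspace of its source, and its image one of its target.\<close>

lemma intertwiner_kernel:
  fixes T :: "complex mat"
  assumes \<pi>: "irreducible_rep \<Gamma> \<pi>" and \<sigma>: "matrix_rep \<Gamma> \<sigma>"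
    and T: "T \<in> carrier_mat (rep_dim \<Gamma> \<sigma>) (rep_dim \<Gamma> \<pi>)"
    and comm: "\<And>\<gamma>. \<gamma> \<in> carrier \<Gamma> \<Longrightarrow> T * \<pi> \<gamma> = \<sigma> \<gamma> * T"
  shows "T = 0\<^sub>m (rep_dim \<Gamma> \<sigma>) (rep_dim \<Gamma> \<pi>) \<or>
    (\<forall>v\<in>carrier_vec (rep_dim \<Gamma> \<pi>). T *\<^sub>v v = 0\<^sub>v (rep_dim \<Gamma> \<sigma>) \<longrightarrow> v = 0\<^sub>v (rep_dim \<Gamma> \<pi>))"
proof -
  let ?m = "rep_dim \<Gamma> \<sigma>" and ?n = "rep_dim \<Gamma> \<pi>"
  let ?K = "{v \<in> carrier_vec ?n. T *\<^sub>v v = 0\<^sub>v ?m}"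
  note \<pi>c = matrix_repD[OF irreducible_repD(1)[OF \<pi>]] and \<sigma>c = matrix_repD[OF \<sigma>]
  have "vec_subspace ?n ?K"
    using T by (auto simp: vec_subspace_def mult_add_distrib_mat_vec mult_mat_vec)
  moreover have "\<pi> \<gamma> *\<^sub>v v \<in> ?K" if "\<gamma> \<in> carrier \<Gamma>" "v \<in> ?K" for \<gamma> v
  proof -
    have "T *\<^sub>v (\<pi> \<gamma> *\<^sub>v v) = (T * \<pi> \<gamma>) *\<^sub>v v"
      using that T \<pi>c(1) by (subst assoc_mult_mat_vec) auto
    also have "\<dots> = \<sigma> \<gamma> *\<^sub>v (T *\<^sub>v v)"
      unfolding comm[OF that(1)] using that T \<sigma>c(1) by (subst assoc_mult_mat_vec) auto
    also have "\<dots> = 0\<^sub>v ?m"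
      using that \<sigma>c(1)[OF that(1)] by auto
    finally show ?thesis
      using that mult_mat_vec_carrier[OF \<pi>c(1)] by auto
  qed
  ultimately have "?K = {0\<^sub>v ?n} \<or> ?K = carrier_vec ?n"
    by (rule irreducible_repD(3)[OF \<pi>])
  then show ?thesis
  proof
    assume K: "?K = carrier_vec ?n"
    have "T $$ (i, j) = 0" if ij: "i < ?m" "j < ?n" for i j
    proof -
      have "unit_vec ?n j \<in> ?K"
        by (subst K) simp
      then have "(T *\<^sub>v unit_vec ?n j) $ i = 0"
        using ij by simp
      then show ?thesis
        using ij T by (simp add: mult_mat_vec_def)
    qed
    then have "T = 0\<^sub>m ?m ?n"
      using T by (intro eq_matI) auto
    then show ?thesis ..
  qed blast
qed

lemma intertwiner_image:
  fixes T :: "complex mat"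
  assumes \<pi>: "matrix_rep \<Gamma> \<pi>" and \<sigma>: "irreducible_rep \<Gamma> \<sigma>"
    and T: "T \<in> carrier_mat (rep_dim \<Gamma> \<sigma>) (rep_dim \<Gamma> \<pi>)"
    and comm: "\<And>\<gamma>. \<gamma> \<in> carrier \<Gamma> \<Longrightarrow> T * \<pi> \<gamma> = \<sigma> \<gamma> * T"
  shows "T = 0\<^sub>m (rep_dim \<Gamma> \<sigma>) (rep_dim \<Gamma> \<pi>) \<or>
    (\<forall>w\<in>carrier_vec (rep_dim \<Gamma> \<sigma>). \<exists>v\<in>carrier_vec (rep_dim \<Gamma> \<pi>). T *\<^sub>v v = w)"
proof -
  let ?m = "rep_dim \<Gamma> \<sigma>" and ?n = "rep_dim \<Gamma> \<pi>"
  let ?R = "(*\<^sub>v) T ` carrier_vec ?n"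
  note \<pi>c = matrix_repD[OF \<pi>] and \<sigma>c = matrix_repD[OF irreducible_repD(1)[OF \<sigma>]]
  have "vec_subspace ?m ?R"
    unfolding vec_subspace_def
  proof (intro conjI ballI allI)
    show "?R \<subseteq> carrier_vec ?m" using T by auto
    show "0\<^sub>v ?m \<in> ?R"
      using T by (intro image_eqI[of _ _ "0\<^sub>v ?n"]) auto
    fix u w assume "u \<in> ?R" "w \<in> ?R"
    then obtain u' w' where "u = T *\<^sub>v u'" "w = T *\<^sub>v w'" "u' \<in> carrier_vec ?n" "w' \<in> carrier_vec ?n"
      by auto
    then show "u + w \<in> ?R"
      using T by (intro image_eqI[of _ _ "u' + w'"]) (auto simp: mult_add_distrib_mat_vec)
  next
    fix c :: complex and u assume "u \<in> ?R"
    then obtain u' where "u = T *\<^sub>v u'" "u' \<in> carrier_vec ?n"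
      by auto
    then show "c \<cdot>\<^sub>v u \<in> ?R"
      using T by (intro image_eqI[of _ _ "c \<cdot>\<^sub>v u'"]) (auto simp: mult_mat_vec)
  qed
  moreover have "\<sigma> \<gamma> *\<^sub>v w \<in> ?R" if g: "\<gamma> \<in> carrier \<Gamma>" and w: "w \<in> ?R" for \<gamma> w
  proof -
    obtain v where v: "w = T *\<^sub>v v" "v \<in> carrier_vec ?n"
      using w by auto
    have "\<sigma> \<gamma> *\<^sub>v w = (\<sigma> \<gamma> * T) *\<^sub>v v"
      unfolding v(1) using g v T \<sigma>c(1) by (subst assoc_mult_mat_vec) auto
    also have "\<dots> = T *\<^sub>v (\<pi> \<gamma> *\<^sub>v v)"
      unfolding comm[OF g, symmetric] using g v T \<pi>c(1) by (subst assoc_mult_mat_vec) auto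
    finally show ?thesis
      using g v mult_mat_vec_carrier[OF \<pi>c(1)] by (metis imageI)
  qed
  ultimately have "?R = {0\<^sub>v ?m} \<or> ?R = carrier_vec ?m"
    by (rule irreducible_repD(3)[OF \<sigma>])
  then show ?thesis
  proof
    assume R: "?R = {0\<^sub>v ?m}"
    have "T $$ (i, j) = 0" if ij: "i < ?m" "j < ?n" for i j
    proof -
      have "T *\<^sub>v unit_vec ?n j \<in> ?R"
        by simp
      then have "(T *\<^sub>v unit_vec ?n j) $ i = 0"
        unfolding R using ij by simp
      then show ?thesis
        using ij T by (simp add: mult_mat_vec_def)
    qed
    then have "T = 0\<^sub>m ?m ?n"
      using T by (intro eq_matI) auto
    then show ?thesis ..
  next
    assume "?R = carrier_vec ?m"
    then show ?thesis
      by (metis imageE)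
  qed
qed

text \<open>A bijective rectangular matrix is square: a two-sided inverse \<open>S\<close> exists, and the traces of
  \<open>S T\<close> and \<open>T S\<close> agree.\<close>

lemma bijective_mat_square:
  fixes T :: "complex mat"
  assumes T: "T \<in> carrier_mat m n"
    and inj: "\<And>v. v \<in> carrier_vec n \<Longrightarrow> T *\<^sub>v v = 0\<^sub>v m \<Longrightarrow> v = 0\<^sub>v n"
    and surj: "\<And>w. w \<in> carrier_vec m \<Longrightarrow> \<exists>v\<in>carrier_vec n. T *\<^sub>v v = w"
  shows "m = n" and "invertible_mat T"
proof -
  obtain s where s: "s k \<in> carrier_vec n" "T *\<^sub>v s k = unit_vec m k" for k
    using surj[of "unit_vec m _"] by (metis unit_vec_carrier)
  define S where "S = mat n m (\<lambda>(i, k). s k $ i)"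
  have S: "S \<in> carrier_mat n m"
    by (simp add: S_def)
  have colS: "col S k = s k" if "k < m" for k
    using that s(1)[of k] by (intro eq_vecI) (auto simp: S_def)
  have TS: "T * S = 1\<^sub>m m"
  proof (rule eq_matI)
    fix i k assume "i < dim_row (1\<^sub>m m :: complex mat)" "k < dim_col (1\<^sub>m m :: complex mat)"
    then have ik: "i < m" "k < m" by auto
    have "(T * S) $$ (i, k) = (T *\<^sub>v s k) $ i"
      using T S ik colS by simp
    then show "(T * S) $$ (i, k) = 1\<^sub>m m $$ (i, k)"
      unfolding s(2) using ik by simp
  qed (use T S in auto)
  have ST: "S * T = 1\<^sub>m n"
  proof (rule eq_matI)
    fix i k assume "i < dim_row (1\<^sub>m n :: complex mat)" "k < dim_col (1\<^sub>m n :: complex mat)"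
    then have ik: "i < n" "k < n" by auto
    let ?u = "unit_vec n k :: complex Matrix.vec"
    have "T *\<^sub>v ((S * T) *\<^sub>v ?u - ?u) = T *\<^sub>v ((S * T) *\<^sub>v ?u) - T *\<^sub>v ?u"
      using T S by (intro mult_minus_distrib_mat_vec[OF T]) auto
    also have "T *\<^sub>v ((S * T) *\<^sub>v ?u) = T *\<^sub>v (S *\<^sub>v (T *\<^sub>v ?u))"
      using T S by (subst assoc_mult_mat_vec[of S n m T n]) auto
    also have "\<dots> = (T * S) *\<^sub>v (T *\<^sub>v ?u)"
      using T S by (subst assoc_mult_mat_vec[of T m n S m]) auto
    also have "\<dots> = T *\<^sub>v ?u"
      unfolding TS using T by simp
    finally have "T *\<^sub>v ((S * T) *\<^sub>v ?u - ?u) = 0\<^sub>v m"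
      using T by auto
    then have "(S * T) *\<^sub>v ?u - ?u = 0\<^sub>v n"
      using T S by (intro inj) auto
    then have "((S * T) *\<^sub>v ?u - ?u) $ i = 0"
      using ik by simp
    then show "(S * T) $$ (i, k) = 1\<^sub>m n $$ (i, k)"
      using ik T S by (simp add: mult_mat_vec_def)
  qed (use T S in auto)
  have "of_nat m = (\<Sum>i<m. (T * S) $$ (i, i))"
    by (simp add: TS)
  also have "\<dots> = (\<Sum>i<m. \<Sum>k<n. T $$ (i, k) * S $$ (k, i))"
    using mat_mult_entry[OF T S] by simp
  also have "\<dots> = (\<Sum>k<n. \<Sum>i<m. S $$ (k, i) * T $$ (i, k))"
    by (subst sum.swap) (simp add: mult.commute)
  also have "\<dots> = (\<Sum>k<n. (S * T) $$ (k, k))"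
    using mat_mult_entry[OF S T] by simp
  also have "\<dots> = of_nat n"
    by (simp add: ST)
  finally show mn: "m = n"
    using of_nat_eq_iff by blast
  show "invertible_mat T"
    using T S TS ST mn unfolding invertible_mat_def inverts_mat_def by auto
qed

lemma schur_inequivalent:
  fixes T :: "complex mat"
  assumes \<pi>: "irreducible_rep \<Gamma> \<pi>" and \<sigma>: "irreducible_rep \<Gamma> \<sigma>"
    and T: "T \<in> carrier_mat (rep_dim \<Gamma> \<sigma>) (rep_dim \<Gamma> \<pi>)"
    and comm: "\<And>\<gamma>. \<gamma> \<in> carrier \<Gamma> \<Longrightarrow> T * \<pi> \<gamma> = \<sigma> \<gamma> * T"
    and neq: "\<not> equivalent_reps \<Gamma> \<pi> \<sigma>"
  shows "T = 0\<^sub>m (rep_dim \<Gamma> \<sigma>) (rep_dim \<Gamma> \<pi>)"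
proof (rule ccontr)
  assume "T \<noteq> 0\<^sub>m (rep_dim \<Gamma> \<sigma>) (rep_dim \<Gamma> \<pi>)"
  then have "\<And>v. v \<in> carrier_vec (rep_dim \<Gamma> \<pi>) \<Longrightarrow> T *\<^sub>v v = 0\<^sub>v (rep_dim \<Gamma> \<sigma>) \<Longrightarrow>
      v = 0\<^sub>v (rep_dim \<Gamma> \<pi>)"
    and "\<And>w. w \<in> carrier_vec (rep_dim \<Gamma> \<sigma>) \<Longrightarrow> \<exists>v\<in>carrier_vec (rep_dim \<Gamma> \<pi>). T *\<^sub>v v = w"
    using intertwiner_kernel[OF \<pi> irreducible_repD(1)[OF \<sigma>] T comm]
      intertwiner_image[OF irreducible_repD(1)[OF \<pi>] \<sigma> T comm] by blast+
  note sq = bijective_mat_square[OF T this]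
  have "equivalent_reps \<Gamma> \<pi> \<sigma>"
    unfolding equivalent_reps_def using sq T comm by auto
  with neq show False ..
qed

lemma schur_scalar:
  fixes T :: "complex mat"
  assumes \<pi>: "irreducible_rep \<Gamma> \<pi>"
    and T: "T \<in> carrier_mat (rep_dim \<Gamma> \<pi>) (rep_dim \<Gamma> \<pi>)"
    and comm: "\<And>\<gamma>. \<gamma> \<in> carrier \<Gamma> \<Longrightarrow> T * \<pi> \<gamma> = \<pi> \<gamma> * T"
  shows "\<exists>c. T = c \<cdot>\<^sub>m 1\<^sub>m (rep_dim \<Gamma> \<pi>)"
proof -
  let ?n = "rep_dim \<Gamma> \<pi>"
  note \<pi>c = matrix_repD[OF irreducible_repD(1)[OF \<pi>]]
  obtain c where "eigenvalue T c"
    using spectrum_non_empty[OF T irreducible_repD(2)[OF \<pi>]] by (auto simp: spectrum_def)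
  then obtain v where v: "v \<in> carrier_vec ?n" "v \<noteq> 0\<^sub>v ?n" "T *\<^sub>v v = c \<cdot>\<^sub>v v"
    using T by (auto simp: eigenvalue_def eigenvector_def)
  \<comment> \<open>\<open>U\<close> is again an intertwiner, and its kernel contains the eigenvector \<open>v\<close>.\<close>
  define U where "U = T - c \<cdot>\<^sub>m 1\<^sub>m ?n"
  have U: "U \<in> carrier_mat ?n ?n"
    unfolding U_def by (intro minus_carrier_mat) simp
  have "U * \<pi> \<gamma> = \<pi> \<gamma> * U" if "\<gamma> \<in> carrier \<Gamma>" for \<gamma>
  proof -
    note p = \<pi>c(1)[OF that]
    have "U * \<pi> \<gamma> = T * \<pi> \<gamma> - c \<cdot>\<^sub>m \<pi> \<gamma>"
      unfolding U_def using p T by (subst minus_mult_distrib_mat) auto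
    also have "\<dots> = \<pi> \<gamma> * T - c \<cdot>\<^sub>m \<pi> \<gamma>"
      by (simp only: comm[OF that])
    also have "\<dots> = \<pi> \<gamma> * U"
      unfolding U_def using p T
      by (subst mult_minus_distrib_mat[OF p]) (auto simp: mult_smult_distrib[OF p])
    finally show ?thesis .
  qed
  note ker = intertwiner_kernel[OF \<pi> irreducible_repD(1)[OF \<pi>] U this]
  have "U *\<^sub>v v = T *\<^sub>v v - (c \<cdot>\<^sub>m 1\<^sub>m ?n) *\<^sub>v v"
    unfolding U_def using T v(1) by (subst minus_mult_distrib_mat_vec) auto
  also have "(c \<cdot>\<^sub>m 1\<^sub>m ?n) *\<^sub>v v = c \<cdot>\<^sub>v v"
    using v(1) by (intro eq_vecI) auto
  finally have "U *\<^sub>v v = 0\<^sub>v ?n"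
    using v by auto
  with ker v have U0: "U = 0\<^sub>m ?n ?n"
    by blast
  have "T = c \<cdot>\<^sub>m 1\<^sub>m ?n"
  proof (rule eq_matI)
    fix i j assume "i < dim_row (c \<cdot>\<^sub>m 1\<^sub>m ?n)" "j < dim_col (c \<cdot>\<^sub>m 1\<^sub>m ?n)"
    then have "i < ?n" "j < ?n" "U $$ (i, j) = 0"
      by (simp_all add: U0)
    then show "T $$ (i, j) = (c \<cdot>\<^sub>m 1\<^sub>m ?n) $$ (i, j)"
      using T by (simp add: U_def)
  qed (use T in auto)
  then show ?thesis ..
qed

text \<open>The sum over the group of \<open>\<sigma>(\<gamma>) A \<pi>(\<gamma>)\<^sup>-\<^sup>1\<close> for the matrix unit \<open>A\<close> with its entry 1 in row \<open>a\<close> and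
  column \<open>b\<close>.\<close>

definition averaged_unit ::
    "('g, 'r) monoid_scheme \<Rightarrow> ('g \<Rightarrow> complex mat) \<Rightarrow> ('g \<Rightarrow> complex mat) \<Rightarrow> nat \<Rightarrow> nat \<Rightarrow> complex mat"
  where
  "averaged_unit \<Gamma> \<sigma> \<pi> a b = mat (rep_dim \<Gamma> \<sigma>) (rep_dim \<Gamma> \<pi>)
     (\<lambda>(k, l). \<Sum>\<gamma>\<in>carrier \<Gamma>. \<sigma> \<gamma> $$ (k, a) * \<pi> (inv\<^bsub>\<Gamma>\<^esub> \<gamma>) $$ (b, l))"

lemma averaged_unit_intertwines:
  assumes grp: "group \<Gamma>"
    and \<pi>: "matrix_rep \<Gamma> \<pi>" and \<sigma>: "matrix_rep \<Gamma> \<sigma>"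
    and a: "a < rep_dim \<Gamma> \<sigma>" and b: "b < rep_dim \<Gamma> \<pi>" and d: "\<delta> \<in> carrier \<Gamma>"
  shows "averaged_unit \<Gamma> \<sigma> \<pi> a b * \<pi> \<delta> = \<sigma> \<delta> * averaged_unit \<Gamma> \<sigma> \<pi> a b" (is "?T * _ = _ * ?T")
proof -
  interpret group \<Gamma> by fact
  let ?m = "rep_dim \<Gamma> \<sigma>" and ?n = "rep_dim \<Gamma> \<pi>"
  note \<pi>c = matrix_repD[OF \<pi>] and \<sigma>c = matrix_repD[OF \<sigma>]
  have T: "?T \<in> carrier_mat ?m ?n"
    by (simp add: averaged_unit_def)
  show ?thesis
  proof (rule eq_matI)
    fix k l assume "k < dim_row (\<sigma> \<delta> * ?T)" "l < dim_col (\<sigma> \<delta> * ?T)"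
    then have kl: "k < ?m" "l < ?n"
      using T \<sigma>c(1)[OF d] by auto
    have "(?T * \<pi> \<delta>) $$ (k, l) = (\<Sum>j<?n. \<Sum>\<gamma>\<in>carrier \<Gamma>.
        \<sigma> \<gamma> $$ (k, a) * \<pi> (inv\<^bsub>\<Gamma>\<^esub> \<gamma>) $$ (b, j) * \<pi> \<delta> $$ (j, l))"
      using kl by (subst mat_mult_entry[OF T \<pi>c(1)[OF d]])
        (simp_all add: averaged_unit_def sum_distrib_right)
    also have "\<dots> = (\<Sum>\<gamma>\<in>carrier \<Gamma>. \<sigma> \<gamma> $$ (k, a) *
        (\<Sum>j<?n. \<pi> (inv\<^bsub>\<Gamma>\<^esub> \<gamma>) $$ (b, j) * \<pi> \<delta> $$ (j, l)))"
      by (subst sum.swap) (simp add: sum_distrib_left mult.assoc)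
    also have "\<dots> = (\<Sum>\<gamma>\<in>carrier \<Gamma>. \<sigma> \<gamma> $$ (k, a) * \<pi> (inv\<^bsub>\<Gamma>\<^esub> \<gamma> \<otimes>\<^bsub>\<Gamma>\<^esub> \<delta>) $$ (b, l))"
      using d kl b by (intro sum.cong refl) (simp add: \<pi>c(3) mat_mult_entry[OF \<pi>c(1) \<pi>c(1)])
    also have "\<dots> = (\<Sum>\<gamma>\<in>carrier \<Gamma>. \<sigma> (\<delta> \<otimes>\<^bsub>\<Gamma>\<^esub> \<gamma>) $$ (k, a) * \<pi> (inv\<^bsub>\<Gamma>\<^esub> \<gamma>) $$ (b, l))"
      \<comment> \<open>substitution of \<open>\<delta> \<gamma>\<close> for \<open>\<gamma>\<close>\<close>
      by (rule sum.reindex_bij_witness[of _ "\<lambda>\<gamma>. \<delta> \<otimes>\<^bsub>\<Gamma>\<^esub> \<gamma>" "\<lambda>\<gamma>. inv\<^bsub>\<Gamma>\<^esub> \<delta> \<otimes>\<^bsub>\<Gamma>\<^esub> \<gamma>"])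
        (use d in \<open>auto simp: m_assoc[symmetric] inv_mult_group\<close>)
    also have "\<dots> = (\<Sum>\<gamma>\<in>carrier \<Gamma>.
        (\<Sum>j<?m. \<sigma> \<delta> $$ (k, j) * \<sigma> \<gamma> $$ (j, a)) * \<pi> (inv\<^bsub>\<Gamma>\<^esub> \<gamma>) $$ (b, l))"
      using d kl a by (intro sum.cong refl) (simp add: \<sigma>c(3) mat_mult_entry[OF \<sigma>c(1) \<sigma>c(1)])
    also have "\<dots> = (\<Sum>j<?m. \<sigma> \<delta> $$ (k, j) *
        (\<Sum>\<gamma>\<in>carrier \<Gamma>. \<sigma> \<gamma> $$ (j, a) * \<pi> (inv\<^bsub>\<Gamma>\<^esub> \<gamma>) $$ (b, l)))"
      unfolding sum_distrib_right sum_distrib_left by (subst sum.swap) (simp add: mult.assoc)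
    also have "\<dots> = (\<sigma> \<delta> * ?T) $$ (k, l)"
      using kl by (subst mat_mult_entry[OF \<sigma>c(1)[OF d] T]) (simp_all add: averaged_unit_def)
    finally show "(?T * \<pi> \<delta>) $$ (k, l) = (\<sigma> \<delta> * ?T) $$ (k, l)" .
  qed (use T \<pi>c(1)[OF d] \<sigma>c(1)[OF d] in auto)
qed

lemma schur_orthogonality_inequivalent:
  assumes "group \<Gamma>" "irreducible_rep \<Gamma> \<pi>" "irreducible_rep \<Gamma> \<sigma>" "\<not> equivalent_reps \<Gamma> \<pi> \<sigma>"
    and "k < rep_dim \<Gamma> \<sigma>" "a < rep_dim \<Gamma> \<sigma>" "b < rep_dim \<Gamma> \<pi>" "l < rep_dim \<Gamma> \<pi>"
  shows "(\<Sum>\<gamma>\<in>carrier \<Gamma>. \<sigma> \<gamma> $$ (k, a) * \<pi> (inv\<^bsub>\<Gamma>\<^esub> \<gamma>) $$ (b, l)) = 0"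
proof -
  have "averaged_unit \<Gamma> \<sigma> \<pi> a b = 0\<^sub>m (rep_dim \<Gamma> \<sigma>) (rep_dim \<Gamma> \<pi>)"
    by (intro schur_inequivalent averaged_unit_intertwines irreducible_repD(1) assms)
      (simp add: averaged_unit_def)
  then have "averaged_unit \<Gamma> \<sigma> \<pi> a b $$ (k, l) = 0"
    using assms by simp
  then show ?thesis
    using assms by (simp add: averaged_unit_def)
qed

lemma schur_orthogonality_same:
  assumes grp: "group \<Gamma>" and fin: "finite (carrier \<Gamma>)" and \<pi>: "irreducible_rep \<Gamma> \<pi>"
    and idx: "k < rep_dim \<Gamma> \<pi>" "a < rep_dim \<Gamma> \<pi>" "b < rep_dim \<Gamma> \<pi>" "l < rep_dim \<Gamma> \<pi>"
  shows "(\<Sum>\<gamma>\<in>carrier \<Gamma>. \<pi> \<gamma> $$ (k, a) * \<pi> (inv\<^bsub>\<Gamma>\<^esub> \<gamma>) $$ (b, l)) =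
    (if k = l \<and> a = b then of_nat (card (carrier \<Gamma>)) / of_nat (rep_dim \<Gamma> \<pi>) else 0)"
proof -
  interpret group \<Gamma> by fact
  let ?n = "rep_dim \<Gamma> \<pi>" and ?T = "averaged_unit \<Gamma> \<pi> \<pi> a b"
  note \<pi>c = matrix_repD[OF irreducible_repD(1)[OF \<pi>]]
  have T: "?T \<in> carrier_mat ?n ?n"
    by (simp add: averaged_unit_def)
  obtain c where c: "?T = c \<cdot>\<^sub>m 1\<^sub>m ?n"
    using schur_scalar[OF \<pi> T averaged_unit_intertwines[OF grp _ _ idx(2,3)]]
      irreducible_repD(1)[OF \<pi>] by blast
  have entry: "(\<Sum>\<gamma>\<in>carrier \<Gamma>. \<pi> \<gamma> $$ (i, a) * \<pi> (inv\<^bsub>\<Gamma>\<^esub> \<gamma>) $$ (b, j)) =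
      (if i = j then c else 0)" if "i < ?n" "j < ?n" for i j
    using arg_cong[OF c, of "\<lambda>A. A $$ (i, j)"] that by (simp add: averaged_unit_def)
  \<comment> \<open>The scalar is found by taking the trace.\<close>
  have "of_nat ?n * c = (\<Sum>i<?n. \<Sum>\<gamma>\<in>carrier \<Gamma>. \<pi> \<gamma> $$ (i, a) * \<pi> (inv\<^bsub>\<Gamma>\<^esub> \<gamma>) $$ (b, i))"
    by (simp add: entry)
  also have "\<dots> = (\<Sum>\<gamma>\<in>carrier \<Gamma>. \<Sum>i<?n. \<pi> (inv\<^bsub>\<Gamma>\<^esub> \<gamma>) $$ (b, i) * \<pi> \<gamma> $$ (i, a))"
    by (subst sum.swap) (simp add: mult.commute)
  also have "\<dots> = (\<Sum>\<gamma>\<in>carrier \<Gamma>. \<pi> (inv\<^bsub>\<Gamma>\<^esub> \<gamma> \<otimes>\<^bsub>\<Gamma>\<^esub> \<gamma>) $$ (b, a))"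
    using idx by (intro sum.cong refl, subst \<pi>c(3)) (auto simp: mat_mult_entry[OF \<pi>c(1) \<pi>c(1)])
  also have "\<dots> = (if a = b then of_nat (card (carrier \<Gamma>)) else 0)"
    using idx by (simp add: \<pi>c(2))
  finally have "c = (if a = b then of_nat (card (carrier \<Gamma>)) / of_nat ?n else 0)"
    using irreducible_repD(2)[OF \<pi>] by (auto simp: field_simps)
  then show ?thesis
    using entry idx by simp
qed


section \<open>Linear independence and finiteness\<close>

text \<open>A linearly independent family in a finitely spanned subspace has a finite index set.\<close>

lemma (in vector_space) finite_independent_family:
  assumes B: "finite B" and span: "\<And>i. i \<in> F \<Longrightarrow> f i \<in> span B"
    and ind: "\<And>S u. \<lbrakk>finite S; S \<subseteq> F; (\<Sum>i\<in>S. scale (u i) (f i)) = 0\<rbrakk> \<Longrightarrow> \<forall>i\<in>S. u i = 0"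
  shows "finite F"
proof -
  have inj: "inj_on f F"
  proof (rule inj_onI, rule ccontr)
    fix i j assume ij: "i \<in> F" "j \<in> F" "f i = f j" "i \<noteq> j"
    have "(\<Sum>k\<in>{i, j}. scale (if k = i then 1 else - 1) (f k)) = 0"
      using ij by simp
    with ij show False
      using ind[of "{i, j}" "\<lambda>k. if k = i then 1 else - 1"] by auto
  qed
  have "independent (f ` F)"
    unfolding independent_explicit_finite_subsets
  proof (intro allI impI ballI)
    fix A u v assume A: "A \<subseteq> f ` F" "finite A" "(\<Sum>v\<in>A. scale (u v) v) = 0" "v \<in> A"
    obtain S where S: "S \<subseteq> F" "A = f ` S" "inj_on f S"
      using A(1) inj by (metis subset_image_iff inj_on_subset)
    then have "finite S"
      using A(2) by (auto dest: finite_imageD)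
    moreover have "(\<Sum>i\<in>S. scale (u (f i)) (f i)) = 0"
      using A(3) unfolding S(2) by (subst (asm) sum.reindex[OF S(3)]) simp
    ultimately have "\<forall>i\<in>S. u (f i) = 0"
      by (intro ind S(1))
    then show "u v = 0"
      using A(4) S(2) by auto
  qed
  then have "finite (f ` F)"
    using independent_span_bound[OF B] span by blast
  then show ?thesis
    using inj by (rule finite_imageD)
qed

lemma sum_fun_apply: "(\<Sum>i\<in>A. f i) x = (\<Sum>i\<in>A. f i x :: 'b::comm_monoid_add)"
  by (induction A rule: infinite_finite_induct) simp_all

lemma vector_space_fun: "vector_space (\<lambda>(c::'k::field) (f::'a \<Rightarrow> 'k) x. c * f x)"
  by unfold_locales (auto simp: algebra_simps fun_eq_iff)

text \<open>The top left matrix coefficients of pairwise inequivalent irreducible representations are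
  linearly independent functions on the group.\<close>

lemma finite_complete_irreps:
  assumes grp: "group \<Gamma>" and fin: "finite (carrier \<Gamma>)" and Irr: "complete_irreps \<Gamma> Irr"
  shows "finite Irr"
proof -
  interpret group \<Gamma> by fact
  interpret F: vector_space "\<lambda>(c::complex) (f::'a \<Rightarrow> complex) x. c * f x"
    by (rule vector_space_fun)
  have irr: "irreducible_rep \<Gamma> \<pi>" if "\<pi> \<in> Irr" for \<pi>
    using Irr that by (auto simp: complete_irreps_def)
  have neq: "\<not> equivalent_reps \<Gamma> \<pi> \<sigma>" if "\<pi> \<in> Irr" "\<sigma> \<in> Irr" "\<pi> \<noteq> \<sigma>" for \<pi> \<sigma>
    using Irr that by (auto simp: complete_irreps_def)
  have dim: "0 < rep_dim \<Gamma> \<pi>" if "\<pi> \<in> Irr" for \<pi>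
    using irreducible_repD(2)[OF irr[OF that]] .
  \<comment> \<open>Cutting off outside the group places the coefficients in the span of the indicators \<open>\<delta> \<gamma>\<close>.\<close>
  define coeff where "coeff \<pi> \<gamma> = (if \<gamma> \<in> carrier \<Gamma> then \<pi> \<gamma> $$ (0, 0) else 0)" for \<pi> :: "'a \<Rightarrow> complex mat" and \<gamma>
  define \<delta> where "\<delta> \<gamma> = (\<lambda>\<gamma>'. if \<gamma>' = \<gamma> then 1 else 0 :: complex)" for \<gamma> :: 'a
  show ?thesis
  proof (rule F.finite_independent_family[of "\<delta> ` carrier \<Gamma>" _ coeff])
    show "finite (\<delta> ` carrier \<Gamma>)"
      using fin by simp
  next
    fix \<pi>
    have "coeff \<pi> = (\<Sum>\<gamma>\<in>carrier \<Gamma>. (\<lambda>x. coeff \<pi> \<gamma> * \<delta> \<gamma> x))"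
      using fin by (auto simp: fun_eq_iff sum_fun_apply coeff_def \<delta>_def if_distrib cong: if_cong)
    also have "\<dots> \<in> F.span (\<delta> ` carrier \<Gamma>)"
      by (intro F.span_sum F.span_scale F.span_base) auto
    finally show "coeff \<pi> \<in> F.span (\<delta> ` carrier \<Gamma>)" .
  next
    fix S u assume S: "finite S" "S \<subseteq> Irr" and 0: "(\<Sum>\<sigma>\<in>S. (\<lambda>x. u \<sigma> * coeff \<sigma> x)) = 0"
    show "\<forall>\<pi>\<in>S. u \<pi> = 0"
    proof
      fix \<pi> assume \<pi>: "\<pi> \<in> S"
      have orth: "(\<Sum>\<gamma>\<in>carrier \<Gamma>. \<sigma> \<gamma> $$ (0, 0) * \<pi> (inv\<^bsub>\<Gamma>\<^esub> \<gamma>) $$ (0, 0)) =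
          (if \<sigma> = \<pi> then of_nat (card (carrier \<Gamma>)) / of_nat (rep_dim \<Gamma> \<pi>) else 0)"
        if "\<sigma> \<in> S" for \<sigma>
        using that \<pi> S schur_orthogonality_same[OF grp fin irr[of \<pi>], of 0 0 0 0]
          schur_orthogonality_inequivalent[OF grp irr[of \<pi>] irr[of \<sigma>], of 0 0 0 0]
          neq[of \<pi> \<sigma>] dim[of \<pi>] dim[of \<sigma>] by auto
      have "0 = (\<Sum>\<gamma>\<in>carrier \<Gamma>. (\<Sum>\<sigma>\<in>S. u \<sigma> * coeff \<sigma> \<gamma>) * \<pi> (inv\<^bsub>\<Gamma>\<^esub> \<gamma>) $$ (0, 0))"
        using fun_cong[OF 0] by (simp add: sum_fun_apply)
      also have "\<dots> = (\<Sum>\<sigma>\<in>S. u \<sigma> *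
          (\<Sum>\<gamma>\<in>carrier \<Gamma>. \<sigma> \<gamma> $$ (0, 0) * \<pi> (inv\<^bsub>\<Gamma>\<^esub> \<gamma>) $$ (0, 0)))"
        unfolding sum_distrib_right sum_distrib_left
        by (subst sum.swap) (simp add: coeff_def mult.assoc)
      also have "\<dots> = u \<pi> * (of_nat (card (carrier \<Gamma>)) / of_nat (rep_dim \<Gamma> \<pi>))"
        using S(1) \<pi> by (simp add: orth if_distrib cong: if_cong)
      finally show "u \<pi> = 0"
        using dim[of \<pi>] \<pi> S(2) fin one_closed by (auto simp: card_eq_0_iff)
    qed
  qed
qed


section \<open>Polynomials of bounded degree\<close>

lemma lookup_scale: "Poly_Mapping.lookup (scale c p) m = c * Poly_Mapping.lookup p m"
proof -
  have "Const c * p = Poly_Mapping.map ((*) c) p"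
    unfolding Const_def by (rule mult_map_scale_conv_mult[symmetric])
  then show ?thesis
    by (simp add: scale_def map.rep_eq when_def)
qed

lemma scale_single: "scale c (Poly_Mapping.single m a) = Poly_Mapping.single m (c * a)"
  by (simp add: scale_def Const_def mult_single)

lemma scale_mult_left: "scale c p * q = scale c (p * q)"
  by (simp add: scale_def mult.assoc)

lemma scale_mult_right: "p * scale c q = scale c (p * q)"
  by (simp add: scale_def mult_ac)

lemma lookup_complexify:
  "Poly_Mapping.lookup (complexify p) m = complex_of_real (Poly_Mapping.lookup p m)"
  by (simp add: complexify_def map.rep_eq when_def)

lemma keys_complexify: "Poly_Mapping.keys (complexify p) = Poly_Mapping.keys p"
  by (auto simp: in_keys_iff lookup_complexify)

lemma eval_complexify:
  "eval (complexify p) (\<lambda>i. complex_of_real (x i)) = complex_of_real (eval p x)"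
  by (simp add: eval_def keys_complexify lookup_complexify)

lemma complexify_zero: "complexify 0 = 0"
  by (rule poly_mapping_eqI) (simp add: lookup_complexify)

lemma mpoly_sum_monomials:
  fixes p :: "('n, 'a::comm_ring_1) mpoly"
  shows "p = (\<Sum>m\<in>Poly_Mapping.keys p. scale (Poly_Mapping.lookup p m) (Poly_Mapping.single m 1))"
  by (rule poly_mapping_eqI)
    (auto simp: lookup_sum scale_single lookup_single when_def in_keys_iff)

lemma monom_degree_add: "monom_degree (a + b) = monom_degree a + monom_degree b"
  by (simp add: monom_degree_def lookup_add sum.distrib)

lemma monom_degree_le_deg: "m \<in> Poly_Mapping.keys p \<Longrightarrow> monom_degree m \<le> deg p"
  unfolding deg_def by (rule Max_ge) auto

lemma deg_homogeneous:
  assumes "homogeneous k p" "p \<noteq> 0"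
  shows "deg p = k"
proof -
  have "monom_degree ` Poly_Mapping.keys p = {k}"
    using assms keys_eq_empty[of p] by (auto simp: homogeneous_def image_constant_conv cong: image_cong_simp)
  then show ?thesis
    by (simp add: deg_def)
qed

lemma finite_monomials: "finite {m :: 'n::finite \<Rightarrow>\<^sub>0 nat. monom_degree m \<le> k}"
proof (rule finite_imageD)
  have "Poly_Mapping.lookup m i \<le> k" if "monom_degree m \<le> k" for m :: "'n \<Rightarrow>\<^sub>0 nat" and i
    using member_le_sum[of i UNIV "Poly_Mapping.lookup m"] that by (simp add: monom_degree_def)
  then have "Poly_Mapping.lookup ` {m :: 'n \<Rightarrow>\<^sub>0 nat. monom_degree m \<le> k} \<subseteq> PiE UNIV (\<lambda>_. {..k})"
    by (auto simp: PiE_def)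
  then show "finite (Poly_Mapping.lookup ` {m :: 'n \<Rightarrow>\<^sub>0 nat. monom_degree m \<le> k})"
    by (rule finite_subset) (intro finite_PiE; simp)
  show "inj_on Poly_Mapping.lookup {m :: 'n \<Rightarrow>\<^sub>0 nat. monom_degree m \<le> k}"
    by (simp add: inj_on_def)
qed

lemma monomial_split:
  fixes m :: "'n::finite \<Rightarrow>\<^sub>0 nat"
  assumes "k \<le> monom_degree m"
  shows "\<exists>a b. m = a + b \<and> monom_degree a = k"
  using assms
proof (induction k)
  case 0
  show ?case
    by (rule exI[of _ 0], rule exI[of _ m]) (simp add: monom_degree_def)
next
  case (Suc k)
  then obtain a b where ab: "m = a + b" "monom_degree a = k"
    by auto
  then have "monom_degree b \<noteq> 0"
    using Suc.prems by (simp add: monom_degree_add)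
  then obtain i where i: "Poly_Mapping.lookup b i \<noteq> 0"
    by (auto simp: monom_degree_def)
  let ?s = "Poly_Mapping.single i 1 :: 'n \<Rightarrow>\<^sub>0 nat"
  have "b = ?s + (b - ?s)"
    using i by (intro poly_mapping_eqI) (auto simp: lookup_add lookup_minus lookup_single when_def)
  then have "m = (a + ?s) + (b - ?s)"
    unfolding ab(1) by (metis add.assoc)
  moreover have "monom_degree ?s = 1"
    by (simp add: monom_degree_def lookup_single when_def)
  then have "monom_degree (a + ?s) = Suc k"
    by (simp add: monom_degree_add ab(2))
  ultimately show ?case
    by blast
qed

text \<open>The monomials of total degree at most \<open>k\<close>, as polynomials with coefficient 1.\<close>

definition monomials_upto :: "nat \<Rightarrow> ('n::finite, 'a::comm_ring_1) mpoly set" where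
  "monomials_upto k = {Poly_Mapping.single m 1 | m. monom_degree m \<le> k}"

lemma finite_monomials_upto: "finite (monomials_upto k)"
  unfolding monomials_upto_def setcompr_eq_image by (rule finite_imageI[OF finite_monomials])

lemma in_span_monomials_upto:
  fixes p :: "('n::finite, 'a::field) mpoly"
  assumes "\<And>m. m \<in> Poly_Mapping.keys p \<Longrightarrow> monom_degree m \<le> k"
  shows "p \<in> mpoly.span (monomials_upto k)"
proof (subst mpoly_sum_monomials[of p], intro mpoly.span_sum mpoly.span_scale mpoly.span_base)
  fix m assume "m \<in> Poly_Mapping.keys p"
  from assms[OF this] show "Poly_Mapping.single m 1 \<in> monomials_upto k"
    by (auto simp: monomials_upto_def)
qed

text \<open>The homogeneous component of degree \<open>r\<close>.\<close>

definition hom_part :: "nat \<Rightarrow> ('n::finite, 'a::comm_ring_1) mpoly \<Rightarrow> ('n, 'a) mpoly" where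
  "hom_part r p = (\<Sum>m\<in>{m\<in>Poly_Mapping.keys p. monom_degree m = r}.
     Poly_Mapping.single m (Poly_Mapping.lookup p m))"

lemma lookup_hom_part:
  "Poly_Mapping.lookup (hom_part r p) m = (if monom_degree m = r then Poly_Mapping.lookup p m else 0)"
  by (auto simp: hom_part_def lookup_sum lookup_single when_def in_keys_iff)

lemma hom_part_sum: "hom_part r (\<Sum>a\<in>A. f a) = (\<Sum>a\<in>A. hom_part r (f a))"
  by (rule poly_mapping_eqI) (simp add: lookup_hom_part lookup_sum)

lemma hom_part_homogeneous:
  assumes "homogeneous k p"
  shows "hom_part r p = (if k = r then p else 0)"
  using assms by (intro poly_mapping_eqI) (auto simp: lookup_hom_part homogeneous_def in_keys_iff)

lemma subspace_homogeneous: "mpoly.subspace {p :: ('n::finite, 'a::field) mpoly. homogeneous k p}"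
proof (rule mpoly.subspaceI)
  fix p q :: "('n, 'a) mpoly" assume "p \<in> {p. homogeneous k p}" "q \<in> {p. homogeneous k p}"
  then show "p + q \<in> {p. homogeneous k p}"
    using keys_add[of p q] by (auto simp: homogeneous_def)
qed (auto simp: homogeneous_def in_keys_iff lookup_scale)


section \<open>Consequences of a real symmetry-adapted basis\<close>

text \<open>Nonzero elements of distinct summands are independent.\<close>

lemma direct_sum_zero:
  assumes dec: "direct_sum_decomposition K H" and S: "finite S" "S \<subseteq> K"
    and f: "\<And>k. k \<in> S \<Longrightarrow> f k \<in> H k" and 0: "(\<Sum>k\<in>S. f k) = 0" and k: "k \<in> S"
  shows "f k = 0"
proof -
  define P where "P g \<longleftrightarrow> (\<forall>k\<in>K. g k \<in> H k) \<and> (\<forall>k. k \<notin> K \<longrightarrow> g k = 0) \<and>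
    finite {k. g k \<noteq> 0} \<and> 0 = (\<Sum>k | g k \<noteq> 0. g k)" for g
  have sub: "mpoly.subspace (H k)" if "k \<in> K" for k
    using dec that by (auto simp: direct_sum_decomposition_def)
  let ?g = "\<lambda>k. if k \<in> S then f k else 0"
  have "(\<Sum>k | ?g k \<noteq> 0. ?g k) = (\<Sum>k\<in>S. f k)"
    by (rule sum.mono_neutral_cong_left) (use S in auto)
  moreover have "finite {k. ?g k \<noteq> 0}"
    by (rule finite_subset[OF _ S(1)]) auto
  ultimately have "P ?g"
    using S f 0 sub by (auto simp: P_def mpoly.subspace_0)
  moreover have "P (\<lambda>_. 0)"
    using sub by (auto simp: P_def mpoly.subspace_0)
  moreover have "\<exists>!g. P g"
    using dec unfolding direct_sum_decomposition_def P_def by blast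
  ultimately have "?g = (\<lambda>_. 0)"
    by blast
  from fun_cong[OF this, of k] k show ?thesis
    by simp
qed

text \<open>Evaluation of a complex polynomial at a real point.\<close>

abbreviation evalc :: "('n::finite, complex) mpoly \<Rightarrow> real ^ 'n \<Rightarrow> complex" where
  "evalc p x \<equiv> eval p (\<lambda>i. of_real (vec_nth x i))"

text \<open>A finite group acting linearly, with a real symmetry-adapted basis; \<open>ec\<close> below is the basis with
  its coefficients regarded as complex numbers.\<close>

locale real_adapted_basis =
  fixes \<Gamma> :: "('g, 'r) monoid_scheme"
    and \<phi> :: "'g \<Rightarrow> real ^ 'n \<Rightarrow> real ^ 'n"
    and Irr :: "('g \<Rightarrow> complex mat) set"
    and I :: "('g \<Rightarrow> complex mat) \<Rightarrow> 'i set"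
    and H :: "('g \<Rightarrow> complex mat) \<Rightarrow> 'i \<Rightarrow> ('n, complex) mpoly set"
    and e :: "('g \<Rightarrow> complex mat) \<Rightarrow> 'i \<Rightarrow> nat \<Rightarrow> ('n, real) mpoly"
  assumes grp: "group \<Gamma>" and fin: "finite (carrier \<Gamma>)" and lin: "linear_action \<Gamma> \<phi>"
    and basis: "real_symmetry_adapted_basis \<Gamma> \<phi> Irr I H e"
begin

abbreviation ec :: "('g \<Rightarrow> complex mat) \<Rightarrow> 'i \<Rightarrow> nat \<Rightarrow> ('n, complex) mpoly" where
  "ec \<pi> i j \<equiv> complexify (e \<pi> i j)"

lemma adapted: "symmetry_adapted_basis \<Gamma> \<phi> Irr I H ec"
  using basis by (simp add: real_symmetry_adapted_basis_def)

lemmas adapted_at = adapted[unfolded symmetry_adapted_basis_def,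
  THEN conjunct2, THEN conjunct2, THEN conjunct2, THEN bspec, THEN bspec]

lemma decomposition: "irreducible_decomposition \<Gamma> \<phi> Irr I H"
  using adapted unfolding symmetry_adapted_basis_def by (elim conjE)

lemmas decomposition_at = decomposition[unfolded irreducible_decomposition_def,
  THEN conjunct2, THEN bspec, THEN bspec]

lemma complete: "complete_irreps \<Gamma> Irr"
  using adapted by (simp add: symmetry_adapted_basis_def)

lemma finite_Irr: "finite Irr"
  using grp fin complete by (rule finite_complete_irreps)

lemma irreducible: "\<pi> \<in> Irr \<Longrightarrow> irreducible_rep \<Gamma> \<pi>"
  using complete by (simp add: complete_irreps_def)

lemma inequivalent: "\<pi> \<in> Irr \<Longrightarrow> \<sigma> \<in> Irr \<Longrightarrow> \<pi> \<noteq> \<sigma> \<Longrightarrow> \<not> equivalent_reps \<Gamma> \<pi> \<sigma>"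
  using complete by (auto simp: complete_irreps_def)

lemma rep_dim_pos: "\<pi> \<in> Irr \<Longrightarrow> 0 < rep_dim \<Gamma> \<pi>"
  using irreducible irreducible_repD(2) by blast

lemma direct_sum: "direct_sum_decomposition (Sigma Irr I) (\<lambda>(\<pi>, i). H \<pi> i)"
  using decomposition unfolding irreducible_decomposition_def by (rule conjunct1)

lemma span_ec: "\<pi> \<in> Irr \<Longrightarrow> i \<in> I \<pi> \<Longrightarrow> mpoly.span (ec \<pi> i ` {..<rep_dim \<Gamma> \<pi>}) = H \<pi> i"
  by (rule adapted_at[THEN conjunct2, THEN conjunct2, THEN conjunct1])

lemma ec_in_H: "\<pi> \<in> Irr \<Longrightarrow> i \<in> I \<pi> \<Longrightarrow> j < rep_dim \<Gamma> \<pi> \<Longrightarrow> ec \<pi> i j \<in> H \<pi> i"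
  using span_ec[of \<pi> i] mpoly.span_base[of "ec \<pi> i j" "ec \<pi> i ` {..<rep_dim \<Gamma> \<pi>}"] by auto

lemma ec_nonzero:
  assumes "\<pi> \<in> Irr" "i \<in> I \<pi>" "j < rep_dim \<Gamma> \<pi>"
  shows "ec \<pi> i j \<noteq> 0"
proof
  assume "ec \<pi> i j = 0"
  then have "0 \<in> ec \<pi> i ` {..<rep_dim \<Gamma> \<pi>}"
    using assms(3) by (intro image_eqI[of _ _ j]) auto
  then have "mpoly.dependent (ec \<pi> i ` {..<rep_dim \<Gamma> \<pi>})"
    by (rule mpoly.dependent_zero)
  moreover have "mpoly.independent (ec \<pi> i ` {..<rep_dim \<Gamma> \<pi>})"
    by (rule adapted_at[OF assms(1,2), THEN conjunct2, THEN conjunct1])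
  ultimately show False
    by (rule notE[rotated])
qed

lemma act_ec:
  "\<pi> \<in> Irr \<Longrightarrow> i \<in> I \<pi> \<Longrightarrow> \<gamma> \<in> carrier \<Gamma> \<Longrightarrow> j < rep_dim \<Gamma> \<pi> \<Longrightarrow>
    act \<Gamma> \<phi> \<gamma> (ec \<pi> i j) = (\<Sum>k<rep_dim \<Gamma> \<pi>. scale (\<pi> \<gamma> $$ (k, j)) (ec \<pi> i k))"
  by (rule adapted_at[THEN conjunct2, THEN conjunct2, THEN conjunct2, THEN bspec, THEN spec, THEN mp])

lemma real_orthogonal: "\<pi> \<in> Irr \<Longrightarrow> i \<in> I \<pi> \<Longrightarrow> real_orthogonal_rep \<Gamma> \<pi>"
  using basis by (auto simp: real_symmetry_adapted_basis_def)

text \<open>The common degree of the polynomials in the homogeneous space \<open>H\<^sub>\<pi>\<^sub>,\<^sub>i\<close>, read off from the basis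
  element with index 0, which exists because \<open>d\<^sub>\<pi> > 0\<close>.\<close>

definition hdeg :: "('g \<Rightarrow> complex mat) \<Rightarrow> 'i \<Rightarrow> nat" where
  "hdeg \<pi> i = deg (e \<pi> i 0)"

lemma H_homogeneous:
  assumes \<pi>: "\<pi> \<in> Irr" "i \<in> I \<pi>"
  shows "p \<in> H \<pi> i \<Longrightarrow> homogeneous (hdeg \<pi> i) p"
    and "j < rep_dim \<Gamma> \<pi> \<Longrightarrow> deg (e \<pi> i j) = hdeg \<pi> i"
proof -
  obtain k B where B: "\<forall>p\<in>B. homogeneous k p" "mpoly.span B = H \<pi> i"
    using decomposition_at[OF \<pi>, THEN conjunct2, THEN conjunct2] by (elim exE conjE)
  have hom: "homogeneous k p" if "p \<in> H \<pi> i" for p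
    using mpoly.span_minimal[OF _ subspace_homogeneous[of k], of B] B that by auto
  have deg: "deg (e \<pi> i j) = k" if "j < rep_dim \<Gamma> \<pi>" for j
  proof (rule deg_homogeneous)
    show "homogeneous k (e \<pi> i j)"
      using hom[OF ec_in_H[OF \<pi> that]] by (simp add: homogeneous_def keys_complexify)
    show "e \<pi> i j \<noteq> 0"
      using ec_nonzero[OF \<pi> that] by (auto simp: complexify_zero)
  qed
  have "hdeg \<pi> i = k"
    using deg rep_dim_pos[OF \<pi>(1)] by (simp add: hdeg_def)
  then show "p \<in> H \<pi> i \<Longrightarrow> homogeneous (hdeg \<pi> i) p"
    and "j < rep_dim \<Gamma> \<pi> \<Longrightarrow> deg (e \<pi> i j) = hdeg \<pi> i"
    using hom deg by auto
qed

lemma block_index_eq: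
  assumes "\<pi> \<in> Irr"
  shows "block_index \<Gamma> I e \<pi> (int k) = {i \<in> I \<pi>. hdeg \<pi> i \<le> k}"
  using H_homogeneous(2)[OF assms] rep_dim_pos[OF assms] by (auto simp: block_index_def)

lemma finite_block_index:
  assumes \<pi>: "\<pi> \<in> Irr"
  shows "finite (block_index \<Gamma> I e \<pi> (int k))"
proof (rule mpoly.finite_independent_family[of "monomials_upto k" _ "\<lambda>i. ec \<pi> i 0"])
  show "finite (monomials_upto k :: ('n, complex) mpoly set)"
    by (rule finite_monomials_upto)
next
  fix i assume "i \<in> block_index \<Gamma> I e \<pi> (int k)"
  then have "deg (e \<pi> i 0) \<le> k"
    using block_index_eq[OF \<pi>] by (simp add: hdeg_def)
  then show "ec \<pi> i 0 \<in> mpoly.span (monomials_upto k)"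
    using monom_degree_le_deg[of _ "e \<pi> i 0"]
    by (intro in_span_monomials_upto) (auto simp: keys_complexify intro: order_trans)
next
  fix S u assume S: "finite S" "S \<subseteq> block_index \<Gamma> I e \<pi> (int k)"
    and 0: "(\<Sum>i\<in>S. scale (u i) (ec \<pi> i 0)) = 0"
  let ?f = "\<lambda>(\<sigma>, i). scale (u i) (ec \<sigma> i 0)"
  have SI: "S \<subseteq> I \<pi>"
    using S(2) by (auto simp: block_index_def)
  show "\<forall>i\<in>S. u i = 0"
  proof
    fix i assume i: "i \<in> S"
    have "?f (\<pi>, i) = 0"
    proof (rule direct_sum_zero[OF direct_sum, of "{\<pi>} \<times> S"])
      fix \<kappa> assume "\<kappa> \<in> {\<pi>} \<times> S"
      then obtain i' where \<kappa>: "\<kappa> = (\<pi>, i')" "i' \<in> S"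
        by auto
      have "scale (u i') (ec \<pi> i' 0) \<in> H \<pi> i'"
        using ec_in_H[OF \<pi> _ rep_dim_pos[OF \<pi>]] \<kappa>(2) SI span_ec[OF \<pi>] mpoly.span_scale by (metis subsetD)
      then show "?f \<kappa> \<in> (case \<kappa> of (\<pi>, i) \<Rightarrow> H \<pi> i)"
        by (simp add: \<kappa>(1))
    next
      show "sum ?f ({\<pi>} \<times> S) = 0"
        using 0 by (simp add: sum.cartesian_product[symmetric])
    qed (use S SI \<pi> i in auto)
    then show "u i = 0"
      using ec_nonzero[OF \<pi> _ rep_dim_pos[OF \<pi>]] i SI by (auto simp: mpoly.scale_eq_0_iff)
  qed
qed

text \<open>The basis polynomials of degree at most \<open>k\<close>.\<close>

definition adapted_upto :: "nat \<Rightarrow> ('n, complex) mpoly set" where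
  "adapted_upto k = {ec \<pi> i j | \<pi> i j.
     \<pi> \<in> Irr \<and> i \<in> block_index \<Gamma> I e \<pi> (int k) \<and> j < rep_dim \<Gamma> \<pi>}"

lemma monomial_in_span_adapted:
  assumes "monom_degree m \<le> k"
  shows "Poly_Mapping.single m 1 \<in> mpoly.span (adapted_upto k)"
proof -
  let ?r = "monom_degree m" and ?p = "Poly_Mapping.single m 1 :: ('n, complex) mpoly"
  obtain f where f: "\<And>\<kappa>. \<kappa> \<in> Sigma Irr I \<Longrightarrow> f \<kappa> \<in> (case \<kappa> of (\<pi>, i) \<Rightarrow> H \<pi> i)"
    "\<And>\<kappa>. \<kappa> \<notin> Sigma Irr I \<Longrightarrow> f \<kappa> = 0" "?p = (\<Sum>\<kappa> | f \<kappa> \<noteq> 0. f \<kappa>)"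
    using direct_sum unfolding direct_sum_decomposition_def by metis
  have "homogeneous ?r ?p"
    by (simp add: homogeneous_def)
  then have "?p = hom_part ?r ?p"
    by (simp add: hom_part_homogeneous)
  \<comment> \<open>Only summands of degree exactly that of \<open>m\<close> survive, and these have degree at most \<open>k\<close>.\<close>
  also have "\<dots> = (\<Sum>\<kappa> | f \<kappa> \<noteq> 0. hom_part ?r (f \<kappa>))"
    by (subst f(3)) (rule hom_part_sum)
  also have "\<dots> \<in> mpoly.span (adapted_upto k)"
  proof (rule mpoly.span_sum)
    fix \<kappa> assume "\<kappa> \<in> {\<kappa>. f \<kappa> \<noteq> 0}"
    then obtain \<pi> i where \<kappa>: "\<kappa> = (\<pi>, i)" and \<pi>: "\<pi> \<in> Irr" "i \<in> I \<pi>"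
      using f(2) by (cases \<kappa>) auto
    have fH: "f \<kappa> \<in> H \<pi> i"
      using f(1)[of \<kappa>] \<kappa> \<pi> by simp
    show "hom_part ?r (f \<kappa>) \<in> mpoly.span (adapted_upto k)"
    proof (cases "hdeg \<pi> i = ?r")
      case True
      then have "i \<in> block_index \<Gamma> I e \<pi> (int k)"
        using block_index_eq[OF \<pi>(1)] \<pi> assms by simp
      then have "ec \<pi> i ` {..<rep_dim \<Gamma> \<pi>} \<subseteq> adapted_upto k"
        using \<pi> by (auto simp: adapted_upto_def)
      then have "H \<pi> i \<subseteq> mpoly.span (adapted_upto k)"
        using mpoly.span_mono span_ec[OF \<pi>] by metis
      then show ?thesis
        using fH True hom_part_homogeneous[OF H_homogeneous(1)[OF \<pi> fH]] by auto
    next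
      case False
      then show ?thesis
        using hom_part_homogeneous[OF H_homogeneous(1)[OF \<pi> fH]] by (simp add: mpoly.span_zero)
    qed
  qed
  finally show ?thesis .
qed

text \<open>Real orthogonality makes the inverse matrix the transpose, so that products of matrix entries can be
  summed without complex conjugation.\<close>

lemma orthogonal_entry:
  assumes \<pi>: "\<pi> \<in> Irr" "i \<in> I \<pi>" and g: "\<gamma> \<in> carrier \<Gamma>"
    and kj: "k < rep_dim \<Gamma> \<pi>" "j < rep_dim \<Gamma> \<pi>"
  shows "\<pi> (inv\<^bsub>\<Gamma>\<^esub> \<gamma>) $$ (j, k) = \<pi> \<gamma> $$ (k, j)"
proof -
  interpret group \<Gamma> by (rule grp)
  let ?n = "rep_dim \<Gamma> \<pi>"
  note \<pi>c = matrix_repD[OF irreducible_repD(1)[OF irreducible[OF \<pi>(1)]]]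
  have c: "\<pi> \<gamma> \<in> carrier_mat ?n ?n" "\<pi> (inv\<^bsub>\<Gamma>\<^esub> \<gamma>) \<in> carrier_mat ?n ?n"
    using g \<pi>c(1) by auto
  have "\<pi> (inv\<^bsub>\<Gamma>\<^esub> \<gamma>) * \<pi> \<gamma> = 1\<^sub>m ?n"
    using \<pi>c(3)[of "inv\<^bsub>\<Gamma>\<^esub> \<gamma>" \<gamma>] \<pi>c(2) g by simp
  moreover have "\<pi> \<gamma> * transpose_mat (\<pi> \<gamma>) = 1\<^sub>m ?n"
    using real_orthogonal[OF \<pi>] g by (simp add: real_orthogonal_rep_def)
  ultimately have "\<pi> (inv\<^bsub>\<Gamma>\<^esub> \<gamma>) = transpose_mat (\<pi> \<gamma>)"
    using c assoc_mult_mat[of "\<pi> (inv\<^bsub>\<Gamma>\<^esub> \<gamma>)" ?n ?n "\<pi> \<gamma>" ?n "transpose_mat (\<pi> \<gamma>)" ?n] by simp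
  then show ?thesis
    using c kj by simp
qed

text \<open>Averaging the product of two basis polynomials over the group gives an entry of \<open>E\<^sub>\<pi>\<close> or
  zero; the sum below is the average without its factor \<open>1 / |\<Gamma>|\<close>.\<close>

lemma orbit_sum_ec_mult:
  assumes \<pi>: "\<pi> \<in> Irr" "i \<in> I \<pi>" "j < rep_dim \<Gamma> \<pi>"
    and \<sigma>: "\<sigma> \<in> Irr" "i' \<in> I \<sigma>" "j' < rep_dim \<Gamma> \<sigma>"
  shows "(\<Sum>\<gamma>\<in>carrier \<Gamma>. evalc (ec \<pi> i j * ec \<sigma> i' j') (\<phi> (inv\<^bsub>\<Gamma>\<^esub> \<gamma>) x)) =
    (if \<pi> = \<sigma> \<and> j = j'
     then of_nat (card (carrier \<Gamma>)) * of_real (eval (E_mat \<Gamma> e \<pi> i i') (vec_nth x)) else 0)"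
proof -
  let ?m = "rep_dim \<Gamma> \<pi>" and ?n = "rep_dim \<Gamma> \<sigma>"
  have ev: "evalc (ec \<tau> k l) (\<phi> (inv\<^bsub>\<Gamma>\<^esub> \<gamma>) x) =
      (\<Sum>a<rep_dim \<Gamma> \<tau>. \<tau> \<gamma> $$ (a, l) * evalc (ec \<tau> k a) x)"
    if "\<tau> \<in> Irr" "k \<in> I \<tau>" "\<gamma> \<in> carrier \<Gamma>" "l < rep_dim \<Gamma> \<tau>" for \<tau> k l \<gamma>
    using eval_act[OF lin grp that(3), of "ec \<tau> k l" x, symmetric]
    by (simp add: act_ec[OF that] eval_sum eval_scale)
  have "(\<Sum>\<gamma>\<in>carrier \<Gamma>. evalc (ec \<pi> i j * ec \<sigma> i' j') (\<phi> (inv\<^bsub>\<Gamma>\<^esub> \<gamma>) x)) =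
      (\<Sum>\<gamma>\<in>carrier \<Gamma>. \<Sum>a<?m. \<Sum>b<?n. (\<pi> \<gamma> $$ (a, j) * \<sigma> (inv\<^bsub>\<Gamma>\<^esub> \<gamma>) $$ (j', b)) *
        (evalc (ec \<pi> i a) x * evalc (ec \<sigma> i' b) x))"
    using \<pi> \<sigma> by (intro sum.cong refl)
      (simp add: eval_mult ev sum_product orthogonal_entry[OF \<sigma>(1,2)] mult_ac)
  also have "\<dots> = (\<Sum>a<?m. \<Sum>b<?n.
      (\<Sum>\<gamma>\<in>carrier \<Gamma>. \<pi> \<gamma> $$ (a, j) * \<sigma> (inv\<^bsub>\<Gamma>\<^esub> \<gamma>) $$ (j', b)) *
        (evalc (ec \<pi> i a) x * evalc (ec \<sigma> i' b) x))"
    unfolding sum_distrib_right by (subst sum.swap, rule sum.cong[OF refl], rule sum.swap)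
  also have "\<dots> = (if \<pi> = \<sigma> \<and> j = j'
     then of_nat (card (carrier \<Gamma>)) * of_real (eval (E_mat \<Gamma> e \<pi> i i') (vec_nth x)) else 0)"
  proof (cases "\<pi> = \<sigma>")
    case False
    then show ?thesis
      using schur_orthogonality_inequivalent[OF grp irreducible irreducible inequivalent] \<pi> \<sigma>
      by (simp add: sum.neutral)
  next
    case True
    have schur: "(\<Sum>\<gamma>\<in>carrier \<Gamma>. \<pi> \<gamma> $$ (a, j) * \<pi> (inv\<^bsub>\<Gamma>\<^esub> \<gamma>) $$ (j', b)) =
        (if a = b \<and> j = j' then of_nat (card (carrier \<Gamma>)) / of_nat ?m else 0)"
      if "a < ?m" "b < ?m" for a b
      by (rule schur_orthogonality_same[OF grp fin irreducible[OF \<pi>(1)] that(1) \<pi>(3)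
          \<sigma>(3)[folded True] that(2)])
    have "(\<Sum>a<?m. \<Sum>b<?n.
        (\<Sum>\<gamma>\<in>carrier \<Gamma>. \<pi> \<gamma> $$ (a, j) * \<sigma> (inv\<^bsub>\<Gamma>\<^esub> \<gamma>) $$ (j', b)) *
          (evalc (ec \<pi> i a) x * evalc (ec \<sigma> i' b) x)) =
      (\<Sum>a<?m. \<Sum>b<?m. if a = b then if j = j' then of_nat (card (carrier \<Gamma>)) / of_nat ?m *
          (evalc (ec \<pi> i a) x * evalc (ec \<pi> i' a) x) else 0 else 0)"
      by (intro sum.cong) (simp_all add: schur True[symmetric])
    also have "\<dots> = (if j = j' then of_nat (card (carrier \<Gamma>)) / of_nat ?m *
        (\<Sum>a<?m. evalc (ec \<pi> i a) x * evalc (ec \<pi> i' a) x) else 0)"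
      by (simp add: sum_distrib_left)
    also have "\<dots> = (if j = j' then of_nat (card (carrier \<Gamma>)) *
        of_real (eval (E_mat \<Gamma> e \<pi> i i') (vec_nth x)) else 0)"
      by (simp add: E_mat_def eval_scale eval_sum eval_mult eval_complexify)
    finally show ?thesis
      using True by simp
  qed
  finally show ?thesis .
qed

text \<open>A combination of point evaluations that annihilates the entries of \<open>E\<^sub>\<pi>\<^sup>d\<close> annihilates all
  invariants of degree at most \<open>2d\<close>.\<close>

lemma annihilates_invariants:
  assumes S: "finite S"
    and E: "\<And>\<pi> i i'. \<lbrakk>\<pi> \<in> Irr; i \<in> block_index \<Gamma> I e \<pi> (int d); i' \<in> block_index \<Gamma> I e \<pi> (int d)\<rbrakk> \<Longrightarrow>
      (\<Sum>x\<in>S. c x * eval (E_mat \<Gamma> e \<pi> i i') (vec_nth x)) = 0"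
    and p: "p \<in> invariants_upto \<Gamma> \<phi> (2 * d)"
  shows "(\<Sum>x\<in>S. c x * eval p (vec_nth x)) = 0"
proof -
  interpret group \<Gamma> by (rule grp)
  \<comment> \<open>\<open>L\<close> is the given combination of evaluations after summation over the group; on invariants the two
    agree up to the factor \<open>|\<Gamma>|\<close>.\<close>
  define L where "L q = (\<Sum>x\<in>S. of_real (c x) * (\<Sum>\<gamma>\<in>carrier \<Gamma>. evalc q (\<phi> (inv\<^bsub>\<Gamma>\<^esub> \<gamma>) x)))" for q
  have L_add: "L (q + r) = L q + L r" for q r
    by (simp add: L_def eval_add sum.distrib distrib_left)
  have L_scale: "L (scale a q) = a * L q" for a q
    by (simp add: L_def eval_scale sum_distrib_left mult_ac)
  have L_0: "L 0 = 0"
    using L_scale[of 0 0] by simp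
  have L_ec: "L (q * r) = 0" if "q \<in> adapted_upto d" "r \<in> adapted_upto d" for q r
  proof -
    obtain \<pi> i j \<sigma> i' j' where *: "q = ec \<pi> i j" "r = ec \<sigma> i' j'"
      "\<pi> \<in> Irr" "i \<in> block_index \<Gamma> I e \<pi> (int d)" "j < rep_dim \<Gamma> \<pi>"
      "\<sigma> \<in> Irr" "i' \<in> block_index \<Gamma> I e \<sigma> (int d)" "j' < rep_dim \<Gamma> \<sigma>"
      using \<open>q \<in> _\<close> \<open>r \<in> _\<close> unfolding adapted_upto_def by blast
    then have **: "i \<in> I \<pi>" "i' \<in> I \<sigma>"
      by (auto simp: block_index_def)
    show ?thesis
    proof (cases "\<pi> = \<sigma> \<and> j = j'")
      case True
      then have "(\<Sum>\<gamma>\<in>carrier \<Gamma>. evalc (q * r) (\<phi> (inv\<^bsub>\<Gamma>\<^esub> \<gamma>) x)) =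
          of_nat (card (carrier \<Gamma>)) * of_real (eval (E_mat \<Gamma> e \<pi> i i') (vec_nth x))" for x
        unfolding *(1,2) by (subst orbit_sum_ec_mult) (use * ** in auto)
      then have "L (q * r) = of_nat (card (carrier \<Gamma>)) *
          of_real (\<Sum>x\<in>S. c x * eval (E_mat \<Gamma> e \<pi> i i') (vec_nth x))"
        by (simp add: L_def sum_distrib_left mult.left_commute)
      also have "\<dots> = 0"
        using E[of \<pi> i i'] * True by simp
      finally show ?thesis .
    next
      case False
      then show ?thesis
        unfolding L_def *(1,2) by (subst orbit_sum_ec_mult) (use * ** in auto)
    qed
  qed
  have L_mult: "L (q * r) = 0"
    if q: "q \<in> mpoly.span (adapted_upto d)" and r: "r \<in> mpoly.span (adapted_upto d)" for q r
  proof -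
    have "L (q' * r) = 0" if "q' \<in> adapted_upto d" for q'
      using r by (induction rule: mpoly.span_induct_alt)
        (simp_all add: L_0 L_add L_scale L_ec that distrib_left scale_mult_right)
    with q show ?thesis
      by (induction rule: mpoly.span_induct_alt)
        (simp_all add: L_0 L_add L_scale distrib_right scale_mult_left)
  qed
  have L_monomial: "L q = 0" if "q \<in> monomials_upto (2 * d)" for q
  proof -
    obtain m where m: "q = Poly_Mapping.single m 1" "monom_degree m \<le> 2 * d"
      using \<open>q \<in> _\<close> by (auto simp: monomials_upto_def)
    obtain a b where ab: "m = a + b" "monom_degree a = min d (monom_degree m)"
      using monomial_split[of "min d (monom_degree m)" m] by auto
    then have "monom_degree a \<le> d" "monom_degree b \<le> d"
      using m(2) by (auto simp: monom_degree_add)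
    moreover have "q = Poly_Mapping.single a 1 * Poly_Mapping.single b 1"
      by (simp add: m(1) ab(1) mult_single)
    ultimately show ?thesis
      using L_mult monomial_in_span_adapted by simp
  qed
  have "complexify p \<in> mpoly.span (monomials_upto (2 * d))"
    using p monom_degree_le_deg[of _ p]
    by (intro in_span_monomials_upto) (fastforce simp: keys_complexify invariants_upto_def)
  then have "L (complexify p) = 0"
    by (induction rule: mpoly.span_induct_alt) (simp_all add: L_0 L_add L_scale L_monomial)
  moreover have "evalc (complexify p) (\<phi> (inv\<^bsub>\<Gamma>\<^esub> \<gamma>) x) = of_real (eval p (vec_nth x))"
    if "\<gamma> \<in> carrier \<Gamma>" for \<gamma> x
    using eval_act[OF lin grp that, of p x] p that
    by (simp add: eval_complexify invariants_upto_def invariant_def)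
  then have "L (complexify p) =
      of_nat (card (carrier \<Gamma>)) * of_real (\<Sum>x\<in>S. c x * eval p (vec_nth x))"
    by (simp add: L_def sum_distrib_left mult_ac)
  ultimately show ?thesis
    using fin one_closed by (auto simp: card_eq_0_iff simp del: of_real_sum)
qed

end


section \<open>The constraints\<close>

lemma minimal_unisolvent_witness:
  assumes "minimal_unisolvent M W" "x \<in> M"
  shows "\<exists>p\<in>W. eval p (vec_nth x) \<noteq> 0 \<and> (\<forall>y\<in>M - {x}. eval p (vec_nth y) = 0)"
proof -
  have "\<not> unisolvent (M - {x}) W" "unisolvent M W"
    using assms by (auto simp: minimal_unisolvent_def)
  then show ?thesis
    unfolding unisolvent_def by (metis insert_Diff insertE assms(2))
qed

lemma finite_minimal_unisolvent:
  assumes M: "minimal_unisolvent M W" and W: "\<And>p. p \<in> W \<Longrightarrow> deg p \<le> k"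
  shows "finite M"
proof -
  obtain q where q: "\<And>x. x \<in> M \<Longrightarrow> q x \<in> W" "\<And>x. x \<in> M \<Longrightarrow> eval (q x) (vec_nth x) \<noteq> 0"
    "\<And>x y. x \<in> M \<Longrightarrow> y \<in> M - {x} \<Longrightarrow> eval (q x) (vec_nth y) = 0"
    using minimal_unisolvent_witness[OF M] by metis
  show ?thesis
  proof (rule mpoly.finite_independent_family[of "monomials_upto k" _ q])
    fix x assume "x \<in> M"
    then show "q x \<in> mpoly.span (monomials_upto k)"
      using W[OF q(1)] monom_degree_le_deg[of _ "q x"]
      by (intro in_span_monomials_upto) (blast intro: order_trans)
  next
    fix S u assume S: "finite S" "S \<subseteq> M" and 0: "(\<Sum>x\<in>S. scale (u x) (q x)) = 0"
    show "\<forall>x\<in>S. u x = 0"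
    proof
      fix x assume x: "x \<in> S"
      have "0 = eval (\<Sum>y\<in>S. scale (u y) (q y)) (vec_nth x)"
        unfolding 0 by (simp add: eval_def)
      also have "\<dots> = (\<Sum>y\<in>S. if y = x then u x * eval (q x) (vec_nth x) else 0)"
        unfolding eval_sum eval_scale using S x q(3) by (intro sum.cong refl) auto
      also have "\<dots> = u x * eval (q x) (vec_nth x)"
        using S x by simp
      finally show "u x = 0"
        using q(2) S x by auto
    qed
  qed (rule finite_monomials_upto)
qed

lemma vector_space_scale_vars: "vector_space scale_vars"
  by unfold_locales (auto simp: scale_vars_def algebra_simps fun_eq_iff)

lemma linear_constraint_functional:
  "Vector_Spaces.linear scale_vars (*) (constraint_functional \<Gamma> Irr I e d P N G x)"
proof -
  have "vector_space ((*) :: real \<Rightarrow> real \<Rightarrow> real)"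
    by unfold_locales (auto simp: algebra_simps)
  then show ?thesis
    unfolding Vector_Spaces.linear_iff
    by (auto simp: vector_space_scale_vars constraint_functional_def scale_vars_def
        algebra_simps sum.distrib sum_distrib_left sum_subtractf split: prod.splits)
qed

lemma constraint_iff:
  "eval (lhs_poly P N v) (vec_nth x) = eval (rhs_poly \<Gamma> Irr I e d G v) (vec_nth x) \<longleftrightarrow>
    constraint_functional \<Gamma> Irr I e d P N G x v = - eval (P 0) (vec_nth x)"
  by (auto simp: lhs_poly_def rhs_poly_def constraint_functional_def trace_inner_def
      eval_add eval_sum eval_mult eval_scale)

lemma trunc_one: "trunc d 1 = int d"
  by (simp add: trunc_def deg_def keys_one monom_degree_def)

lemma E_mat_commute: "E_mat \<Gamma> e \<pi> i i' = E_mat \<Gamma> e \<pi> i' i"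
  by (simp add: E_mat_def mult.commute)

text \<open>A symmetric matrix unit as the only nonzero variable, in the block of \<open>g = 1\<close> and \<open>\<pi>\<close>, selects an
  entry of \<open>E\<^sub>\<pi>\<^sup>d\<close>, up to the factor \<open>- 2\<close>.\<close>

lemma constraint_functional_unit:
  fixes I :: "('g \<Rightarrow> complex mat) \<Rightarrow> 'i set"
    and e :: "('g \<Rightarrow> complex mat) \<Rightarrow> 'i \<Rightarrow> nat \<Rightarrow> ('n::finite, real) mpoly"
  assumes Irr: "finite Irr" and G: "finite G" and \<pi>: "\<pi> \<in> Irr"
    and J: "finite (block_index \<Gamma> I e \<pi> (int d))"
    and i: "i \<in> block_index \<Gamma> I e \<pi> (int d)" and i': "i' \<in> block_index \<Gamma> I e \<pi> (int d)"
  shows "\<exists>v\<in>var_space \<Gamma> Irr I e d N G. \<forall>x.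
    constraint_functional \<Gamma> Irr I e d P N G x v = - 2 * eval (E_mat \<Gamma> e \<pi> i i') (vec_nth x)"
proof
  \<comment> \<open>For \<open>i = i'\<close> the diagonal entry of \<open>A\<close> is 2, so that the factor 2 is the same in all cases.\<close>
  define A :: "'i \<Rightarrow> 'i \<Rightarrow> real" where
    "A a b = of_bool (a = i \<and> b = i') + of_bool (a = i' \<and> b = i)" for a b
  define Y where "Y g \<sigma> a b = of_bool (g = 1 \<and> \<sigma> = \<pi>) * A a b" for g :: "('n, real) mpoly" and \<sigma> a b
  have Y_sym: "Y g \<sigma> a b = Y g \<sigma> b a" for g \<sigma> a b
    by (simp add: Y_def A_def add.commute conj_commute)
  have Y_supp: "g \<in> insert 1 G \<and> \<sigma> \<in> Irr \<and> a \<in> block_index \<Gamma> I e \<sigma> (trunc d g) \<and>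
      b \<in> block_index \<Gamma> I e \<sigma> (trunc d g)" if "Y g \<sigma> a b \<noteq> 0" for g \<sigma> a b
  proof -
    have "g = 1" "\<sigma> = \<pi>" "a = i \<and> b = i' \<or> a = i' \<and> b = i"
      using that by (auto simp: Y_def A_def split: if_splits)
    then show ?thesis
      using \<pi> i i' by (elim disjE) (simp_all add: trunc_one)
  qed
  show "(\<lambda>_. 0, Y) \<in> var_space \<Gamma> Irr I e d N G"
    unfolding var_space_def mem_Collect_eq prod.case
  proof (intro conjI allI impI)
    fix g \<sigma> a b
    show "Y g \<sigma> a b = Y g \<sigma> b a"
      by (rule Y_sym)
    assume "\<not> (g \<in> insert 1 G \<and> \<sigma> \<in> Irr \<and> a \<in> block_index \<Gamma> I e \<sigma> (trunc d g) \<and>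
      b \<in> block_index \<Gamma> I e \<sigma> (trunc d g))"
    then show "Y g \<sigma> a b = 0"
      using Y_supp by (rule contrapos_np)
  qed (rule refl)
  show "\<forall>x. constraint_functional \<Gamma> Irr I e d P N G x (\<lambda>_. 0, Y) =
      - 2 * eval (E_mat \<Gamma> e \<pi> i i') (vec_nth x)"
  proof
    fix x :: "real ^ 'n"
    let ?J = "block_index \<Gamma> I e \<pi> (int d)" and ?E = "\<lambda>a b. eval (E_mat \<Gamma> e \<pi> a b) (vec_nth x)"
    define Q where "Q g \<sigma> = (\<Sum>a\<in>block_index \<Gamma> I e \<sigma> (trunc d g). \<Sum>b\<in>block_index \<Gamma> I e \<sigma> (trunc d g).
      Y g \<sigma> a b * eval (E_mat \<Gamma> e \<sigma> a b) (vec_nth x))" for g \<sigma>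
    have Q: "Q g \<sigma> = (if g = 1 \<and> \<sigma> = \<pi> then \<Sum>a\<in>?J. \<Sum>b\<in>?J. A a b * ?E a b else 0)" for g \<sigma>
      by (auto simp: Q_def Y_def trunc_one)
    have unit: "(\<Sum>a\<in>?J. \<Sum>b\<in>?J. of_bool (a = k \<and> b = l) * ?E a b) = ?E k l"
      if "k \<in> ?J" "l \<in> ?J" for k l
    proof -
      have "(\<Sum>a\<in>?J. \<Sum>b\<in>?J. of_bool (a = k \<and> b = l) * ?E a b) =
          (\<Sum>a\<in>?J. \<Sum>b\<in>?J. if b = l then if a = k then ?E k l else 0 else 0)"
        by (intro sum.cong refl) auto
      then show ?thesis
        using J that by simp
    qed
    have "(\<Sum>a\<in>?J. \<Sum>b\<in>?J. A a b * ?E a b) = ?E i i' + ?E i' i"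
      unfolding A_def distrib_right sum.distrib using unit i i' by simp
    also have "?E i' i = ?E i i'"
      by (simp only: E_mat_commute)
    finally have AE: "(\<Sum>a\<in>?J. \<Sum>b\<in>?J. A a b * ?E a b) = 2 * ?E i i'"
      by simp
    have "constraint_functional \<Gamma> Irr I e d P N G x (\<lambda>_. 0, Y) =
        - (\<Sum>g\<in>insert 1 G. eval g (vec_nth x) * (\<Sum>\<sigma>\<in>Irr. Q g \<sigma>))"
      by (simp add: constraint_functional_def Q_def)
    also have "(\<Sum>g\<in>insert 1 G. eval g (vec_nth x) * (\<Sum>\<sigma>\<in>Irr. Q g \<sigma>)) =
        (\<Sum>g\<in>insert 1 G. if g = 1 then 2 * ?E i i' else 0)"
    proof (rule sum.cong[OF refl])
      fix g assume "g \<in> insert 1 G"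
      have "(\<Sum>\<sigma>\<in>Irr. Q g \<sigma>) = (\<Sum>\<sigma>\<in>Irr. if \<sigma> = \<pi> then if g = 1 then 2 * ?E i i' else 0 else 0)"
        unfolding Q AE by (intro sum.cong refl) auto
      also have "\<dots> = (if g = 1 then 2 * ?E i i' else 0)"
        using Irr \<pi> by simp
      finally show "eval g (vec_nth x) * (\<Sum>\<sigma>\<in>Irr. Q g \<sigma>) = (if g = 1 then 2 * ?E i i' else 0)"
        by (simp add: eval_one)
    qed
    also have "\<dots> = 2 * ?E i i'"
      using G by simp
    finally show "constraint_functional \<Gamma> Irr I e d P N G x (\<lambda>_. 0, Y) = - 2 * ?E i i'"
      by simp
  qed
qed

theorem proposition4p2:
  fixes \<Gamma> :: "('g, 'r) monoid_scheme"
    and \<phi> :: "'g \<Rightarrow> real ^ 'n \<Rightarrow> real ^ 'n"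
    and Irr :: "('g \<Rightarrow> complex mat) set"
    and I :: "('g \<Rightarrow> complex mat) \<Rightarrow> 'i set"
    and H :: "('g \<Rightarrow> complex mat) \<Rightarrow> 'i \<Rightarrow> ('n, complex) mpoly set"
    and e :: "('g \<Rightarrow> complex mat) \<Rightarrow> 'i \<Rightarrow> nat \<Rightarrow> ('n, real) mpoly"
    and d N :: nat
    and P :: "nat \<Rightarrow> ('n, real) mpoly"
    and G :: "('n, real) mpoly set"
    and M :: "(real ^ 'n) set"
  assumes "group \<Gamma>" and "finite (carrier \<Gamma>)"
    and "linear_action \<Gamma> \<phi>"
    and "\<forall>i\<le>N. invariant \<Gamma> \<phi> (P i)"
    and "finite G" and "\<forall>g\<in>G. invariant \<Gamma> \<phi> g"
    and "real_symmetry_adapted_basis \<Gamma> \<phi> Irr I H e"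
    and "minimal_unisolvent M (invariants_upto \<Gamma> \<phi> (2 * d))"
  shows "let V = var_space \<Gamma> Irr I e d N G; l = constraint_functional \<Gamma> Irr I e d P N G in
    finite M \<and>
    (\<forall>x\<in>M. Vector_Spaces.linear scale_vars (*) (l x) \<and>
      (\<forall>v\<in>V. eval (lhs_poly P N v) (vec_nth x) = eval (rhs_poly \<Gamma> Irr I e d G v) (vec_nth x)
        \<longleftrightarrow> l x v = - eval (P 0) (vec_nth x))) \<and>
    independent_functionals V M l"
proof -
  interpret real_adapted_basis \<Gamma> \<phi> Irr I H e
    using assms(1,2,3,7) by (rule real_adapted_basis.intro)
  let ?V = "var_space \<Gamma> Irr I e d N G" and ?l = "constraint_functional \<Gamma> Irr I e d P N G"
  have finM: "finite M"
    using assms(8) by (rule finite_minimal_unisolvent[where k = "2 * d"]) (simp add: invariants_upto_def)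
  have "independent_functionals ?V M ?l"
    unfolding independent_functionals_def
  proof (intro allI impI ballI)
    fix S c x assume *: "finite S \<and> S \<subseteq> M \<and> (\<forall>v\<in>?V. (\<Sum>x\<in>S. c x * ?l x v) = 0)" and x: "x \<in> S"
    obtain p where p: "p \<in> invariants_upto \<Gamma> \<phi> (2 * d)" "eval p (vec_nth x) \<noteq> 0"
      "\<And>y. y \<in> M - {x} \<Longrightarrow> eval p (vec_nth y) = 0"
      using minimal_unisolvent_witness[OF assms(8) subsetD[OF *[THEN conjunct2, THEN conjunct1] x]]
      by (elim bexE conjE) blast
    have "0 = (\<Sum>y\<in>S. c y * eval p (vec_nth y))"
    proof (rule annihilates_invariants[OF _ _ p(1), symmetric])
      fix \<pi> i i' assume \<pi>: "\<pi> \<in> Irr" and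
        i: "i \<in> block_index \<Gamma> I e \<pi> (int d)" "i' \<in> block_index \<Gamma> I e \<pi> (int d)"
      obtain v where v: "v \<in> ?V" "\<forall>y. ?l y v = - 2 * eval (E_mat \<Gamma> e \<pi> i i') (vec_nth y)"
        using constraint_functional_unit[OF finite_Irr assms(5) \<pi> finite_block_index[OF \<pi>] i]
        by (rule bexE)
      have "(\<Sum>y\<in>S. c y * ?l y v) = 0"
        using *[THEN conjunct2, THEN conjunct2] v(1) by (rule bspec)
      then have "(\<Sum>y\<in>S. c y * (- 2 * eval (E_mat \<Gamma> e \<pi> i i') (vec_nth y))) = 0"
        unfolding v(2)[rule_format] .
      then have "- 2 * (\<Sum>y\<in>S. c y * eval (E_mat \<Gamma> e \<pi> i i') (vec_nth y)) = 0"
        unfolding sum_distrib_left by (simp add: mult_ac)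
      then show "(\<Sum>y\<in>S. c y * eval (E_mat \<Gamma> e \<pi> i i') (vec_nth y)) = 0"
        by simp
    qed (rule *[THEN conjunct1])
    also have "\<dots> = (\<Sum>y\<in>S. if y = x then c x * eval p (vec_nth x) else 0)"
      using * p(3) by (intro sum.cong refl) auto
    also have "\<dots> = c x * eval p (vec_nth x)"
      using * x by simp
    finally show "c x = 0"
      using p(2) by simp
  qed
  then show ?thesis
    unfolding Let_def by (intro conjI ballI finM linear_constraint_functional constraint_iff)
qed

end
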